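(* Let $n-2\ge d>r\ge 0$ and $a_d\ge 1$. The Hilbert scheme $\mathrm{Hilb}^{Q(d,r;a_d,1)+1}\mathbf{P}^n$ has exactly two Borel fixed points if and only if one of the following holds: (i) $r=0$ and $a_d=1$; (ii) $r=1$ and $a_d\ne 2$; (iii) $r\ge 2$. In that case the two Borel fixed ideals are $$I_{\mathrm{exp}}=(x_0,\dots,x_{n-d-3})+x_{n-d-2}(x_{n-d-2},\dots,x_{n-1})+x_{n-d-1}^{a_d}(x_{n-d-1},x_{n-d},\dots,x_{n-r-1}),$$ $$I_{\mathrm{lex}}=(x_0,\dots,x_{n-d-2})+x_{n-d-1}^{a_d}(x_{n-d-1},x_{n-d},\dots,x_{n-r-2})+x_{n-d-1}^{a_d}x_{n-r-1}(x_{n-r-1},\dots,x_{n-1}).$$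
   Context: $k$ algebraically closed of characteristic $0$, $S=k[x_0,\dots,x_n]$; a list $(x_0,\dots,x_j)$ with $j<0$ (or a list $x_a,\dots,x_b$ with $b<a$) is empty. Notation $Q$: for integers $i_1>\dots>i_l\ge 0$ and positive integers $a_{i_1},\dots,a_{i_l}$, put $a_j=0$ for $j\notin\{i_1,\dots,i_l\}$, $m_i=\sum_{j\ge i}a_j$ for $0\le i\le i_1$, and $Q(i_1,\dots,i_l;a_{i_1},\dots,a_{i_l})(t)=\sum_{i=0}^{i_1}\left[\binom{t+i}{i+1}-\binom{t+i-m_i}{i+1}\right]$. So $Q(d,r;a,1)$ has $m_i=a$ for $r<i\le d$ and $m_i=a+1$ for $0\le i\le r$. A saturated homogeneous ideal is Borel fixed if fixed by the upper triangular matrices of $\mathrm{GL}_{n+1}$ acting via $x_i\mapsto\sum_j a_{ij}x_j$.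
   Formalization: The upper triangular matrices act by x_i ↦ Σ_j a_ji x_j (so x_0 ↦ a_00 x_0) instead of x_i ↦ Σ_j a_ij x_j; under the latter the listed ideals, which for instance contain x_0 but not x_n, would not be Borel fixed. *)

theory Defs
  imports "HOL-Library.Poly_Mapping" "HOL-Computational_Algebra.Polynomial"
begin

text \<open>Polynomials over 'k in the variables x_0, x_1, ...: a monomial is a finitely
  supported exponent vector (nat, nat) poly_mapping, a polynomial a finitely
  supported coefficient function on monomials.  S = k[x_0,...,x_n] is the set of
  polynomials all of whose monomials only involve the variables x_0..x_n.\<close>

type_synonym 'k mpoly = "((nat, nat) poly_mapping, 'k) poly_mapping"

definition alg_closed :: "'k::field itself \<Rightarrow> bool" where
  "alg_closed _ \<longleftrightarrow> (\<forall>p::'k poly. degree p \<ge> 1 \<longrightarrow> (\<exists>x. poly p x = 0))"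

definition Var :: "nat \<Rightarrow> 'k::comm_ring_1 mpoly" where
  "Var i = Poly_Mapping.single (Poly_Mapping.single i 1) 1"

definition const :: "'k::comm_ring_1 \<Rightarrow> 'k mpoly" where
  "const c = Poly_Mapping.single 0 c"

definition monom_deg :: "(nat, nat) poly_mapping \<Rightarrow> nat" where
  "monom_deg m = (\<Sum>i\<in>Poly_Mapping.keys m. Poly_Mapping.lookup m i)"

definition Sring :: "nat \<Rightarrow> 'k::comm_ring_1 mpoly set" where
  "Sring n = {p. \<forall>m\<in>Poly_Mapping.keys p. Poly_Mapping.keys m \<subseteq> {0..n}}"

definition homog :: "nat \<Rightarrow> nat \<Rightarrow> 'k::comm_ring_1 mpoly set" where
  "homog n t = {p \<in> Sring n. \<forall>m\<in>Poly_Mapping.keys p. monom_deg m = t}"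

definition hcomp :: "nat \<Rightarrow> 'k::comm_ring_1 mpoly \<Rightarrow> 'k mpoly" where
  "hcomp t p = Abs_poly_mapping (\<lambda>m. if monom_deg m = t then Poly_Mapping.lookup p m else 0)"

definition is_ideal :: "nat \<Rightarrow> 'k::comm_ring_1 mpoly set \<Rightarrow> bool" where
  "is_ideal n I \<longleftrightarrow> I \<subseteq> Sring n \<and> 0 \<in> I \<and> (\<forall>f\<in>I. \<forall>g\<in>I. f + g \<in> I)
     \<and> (\<forall>f\<in>I. \<forall>g\<in>Sring n. g * f \<in> I)"

definition homogeneous_ideal :: "nat \<Rightarrow> 'k::comm_ring_1 mpoly set \<Rightarrow> bool" where
  "homogeneous_ideal n I \<longleftrightarrow> is_ideal n I \<and> (\<forall>f\<in>I. \<forall>t. hcomp t f \<in> I)"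

text \<open>Saturation with respect to the irrelevant ideal m = (x_0,...,x_n):
  I = (I : m^\<infinity>), where m^k is generated by the monomials of degree k in x_0..x_n.\<close>
definition saturated :: "nat \<Rightarrow> 'k::comm_ring_1 mpoly set \<Rightarrow> bool" where
  "saturated n I \<longleftrightarrow> (\<forall>f\<in>Sring n.
      (\<exists>k. \<forall>\<mu>. Poly_Mapping.keys \<mu> \<subseteq> {0..n} \<and> monom_deg \<mu> = k \<longrightarrow> Poly_Mapping.single \<mu> 1 * f \<in> I)
      \<longrightarrow> f \<in> I)"

definition gen_ideal :: "nat \<Rightarrow> 'k::comm_ring_1 mpoly set \<Rightarrow> 'k mpoly set" where
  "gen_ideal n G = {p. \<exists>F c. finite F \<and> F \<subseteq> G \<and> (\<forall>g\<in>F. c g \<in> Sring n)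
       \<and> p = (\<Sum>g\<in>F. c g * g)}"

text \<open>Hilbert function of S/I: dimension over k of (S/I)_t, i.e. the maximal size
  of a family of degree-t forms that is linearly independent modulo I.\<close>
definition lin_indep_mod :: "'k::comm_ring_1 mpoly set \<Rightarrow> 'k mpoly set \<Rightarrow> bool" where
  "lin_indep_mod I B \<longleftrightarrow> (\<forall>c. (\<Sum>b\<in>B. const (c b) * b) \<in> I \<longrightarrow> (\<forall>b\<in>B. c b = 0))"

definition hilb_fun :: "nat \<Rightarrow> 'k::comm_ring_1 mpoly set \<Rightarrow> nat \<Rightarrow> nat" where
  "hilb_fun n I t = Max {card B | B. finite B \<and> B \<subseteq> homog n t \<and> lin_indep_mod I B}"

definition has_hilb_poly :: "nat \<Rightarrow> 'k::comm_ring_1 mpoly set \<Rightarrow> (nat \<Rightarrow> int) \<Rightarrow> bool" where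
  "has_hilb_poly n I P \<longleftrightarrow> (\<exists>t0. \<forall>t\<ge>t0. int (hilb_fun n I t) = P t)"

definition subst :: "(nat \<Rightarrow> 'k::comm_ring_1 mpoly) \<Rightarrow> 'k mpoly \<Rightarrow> 'k mpoly" where
  "subst \<sigma> p = (\<Sum>m\<in>Poly_Mapping.keys p. const (Poly_Mapping.lookup p m) * (\<Prod>i\<in>Poly_Mapping.keys m. \<sigma> i ^ Poly_Mapping.lookup m i))"

definition upper_tri_inv :: "nat \<Rightarrow> (nat \<Rightarrow> nat \<Rightarrow> 'k::field) \<Rightarrow> bool" where
  "upper_tri_inv n A \<longleftrightarrow> (\<forall>i\<le>n. \<forall>j\<le>n. j < i \<longrightarrow> A i j = 0) \<and> (\<forall>i\<le>n. A i i \<noteq> 0)"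

definition borel_act :: "nat \<Rightarrow> (nat \<Rightarrow> nat \<Rightarrow> 'k::field) \<Rightarrow> 'k mpoly \<Rightarrow> 'k mpoly" where
  "borel_act n A = subst (\<lambda>i. \<Sum>j=0..n. const (A j i) * Var j)"

definition borel_fixed :: "nat \<Rightarrow> 'k::field mpoly set \<Rightarrow> bool" where
  "borel_fixed n I \<longleftrightarrow> (\<forall>A. upper_tri_inv n A \<longrightarrow> borel_act n A ` I = I)"

definition hilb_borel_points :: "nat \<Rightarrow> (nat \<Rightarrow> int) \<Rightarrow> 'k::field mpoly set set" where
  "hilb_borel_points n P = {I. homogeneous_ideal n I \<and> saturated n I
       \<and> has_hilb_poly n I P \<and> borel_fixed n I}"

text \<open>The polynomial Q(i_1,...,i_l; a_{i_1},...,a_{i_l}), with a given as a function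
  (a j = 0 off the index set), i1 the top index.  Only values for large t matter.\<close>
definition Qm :: "(nat \<Rightarrow> nat) \<Rightarrow> nat \<Rightarrow> nat \<Rightarrow> nat" where
  "Qm a i1 i = (\<Sum>j=i..i1. a j)"

definition Qpoly :: "(nat \<Rightarrow> nat) \<Rightarrow> nat \<Rightarrow> nat \<Rightarrow> int" where
  "Qpoly a i1 t = (\<Sum>i=0..i1. int ((t + i) choose (i + 1)) - int ((t + i - Qm a i1 i) choose (i + 1)))"

definition Q_dr :: "nat \<Rightarrow> nat \<Rightarrow> nat \<Rightarrow> nat \<Rightarrow> int" where
  "Q_dr d r ad = Qpoly (\<lambda>j. if j = d then ad else if j = r then 1 else 0) d"

definition I_exp :: "nat \<Rightarrow> nat \<Rightarrow> nat \<Rightarrow> nat \<Rightarrow> 'k::comm_ring_1 mpoly set" where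
  "I_exp n d r ad = gen_ideal n (
      {Var i | i. i < n - d - 2}
    \<union> {Var (n-d-2) * Var j | j. n-d-2 \<le> j \<and> j \<le> n - 1}
    \<union> {Var (n-d-1) ^ ad * Var j | j. n-d-1 \<le> j \<and> j \<le> n - r - 1})"

definition I_lex :: "nat \<Rightarrow> nat \<Rightarrow> nat \<Rightarrow> nat \<Rightarrow> 'k::comm_ring_1 mpoly set" where
  "I_lex n d r ad = gen_ideal n (
      {Var i | i. i \<le> n - d - 2}
    \<union> {Var (n-d-1) ^ ad * Var j | j. n-d-1 \<le> j \<and> j \<le> n - r - 2}
    \<union> {Var (n-d-1) ^ ad * Var (n-r-1) * Var j | j. n-r-1 \<le> j \<and> j \<le> n - 1})"

end

(* In characteristic 0 a saturated Borel fixed ideal is monomial, and its standard monomials form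
   an order ideal N that is closed under raising the index of a variable and under multiplication
   by x_n; its Hilbert function counts the elements of N by degree.  Put k = n-d-1 and q = n-r.  The
   count Q(d,r;a,1)+1 equals
     sum_{i<a} C(t-i+d,d) + C(t-a+r,r) + 1,
   and each summand is the count of a cone: comparing growth rates forces the cones
   x_k^i k[x_{k+1},...,x_n] for i<a into N (otherwise x_{k-1} k[x_{k+1},...,x_n] lies in N and the
   count is too large), then x_k^a k[x_q,...,x_n] (otherwise x_{k-1} k[x_q,...,x_n] lies in N, which is
   possible only if r=1 and a=2), and what is left is a single monomial in every large degree, hence
   x_{k-1} x_n^s or x_k^a x_{q-1} x_n^s.  These are the expanded and the lexicographic point. *)
theory Submission
  imports Defs
begin

section \<open>Monomials and cones\<close>

text \<open>Two opposite uses of the exchange property drive the argument. A factor of high degree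
  in \<open>x_0,...,x_p\<close> can be traded for a high power of \<open>x_p\<close>; conversely, if
  \<open>u\<close> times every power of \<open>x_p\<close> is standard, then so is the whole cone
  over \<open>u\<close> in \<open>x_p,...,x_n\<close>. Hence a missing cone bounds a partial degree
  on the rest of \<open>N\<close>, and this lowers the order of growth of the rest by one. That is
  how growth rates force cones into \<open>N\<close>: C(t-a+s,s) eventually beats every multiple of
  C(t+s-1,s-1). Growth cannot decide between cones of equal dimension. There the exact count enters:
  replacing the residual cone over \<open>x_k^a\<close> by the one over \<open>x_{k-1}\<close>
  requires C(t-1+r,r) <= C(t-a+r,r)+1. For \<open>a = 1\<close> the cone over \<open>x_{k-1}\<close>
  already forces the one over \<open>x_k\<close>. For \<open>a >= 2\<close> the inequality fails if
  \<open>r >= 2\<close>, says \<open>a <= 2\<close> if \<open>r = 1\<close>, and always holds if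
  \<open>r = 0\<close>. The exceptional parameters are those where such a replacement really gives a
  further order ideal. Counts are known only in large degrees, but \<open>N\<close> is closed under
  division and under multiplication by \<open>x_n\<close>, so large degrees determine
  \<open>N\<close>.\<close>

type_synonym mon = "(nat, nat) poly_mapping"

definition evar :: "nat \<Rightarrow> mon" where
  "evar i = Poly_Mapping.single i 1"

lemma lookup_evar: "Poly_Mapping.lookup (evar i) j = (if i = j then 1 else 0)"
  by (simp add: evar_def lookup_single)

lemma lookup_single_if: "Poly_Mapping.lookup (Poly_Mapping.single i c) j = (if i = j then c else 0)"
  by (simp add: lookup_single)

lemmas mon_lookup = lookup_add lookup_minus lookup_evar lookup_single_if

lemma keys_evar [simp]: "Poly_Mapping.keys (evar i) = {i}"
  by (simp add: evar_def)

lemma single_Suc: "Poly_Mapping.single p (Suc K) = evar p + Poly_Mapping.single p K"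
  by (rule poly_mapping_eqI) (simp add: mon_lookup)

lemma keys_add_nat: "Poly_Mapping.keys (a + b :: mon) = Poly_Mapping.keys a \<union> Poly_Mapping.keys b"
  by (auto simp: in_keys_iff mon_lookup)

lemma evar_factor:
  assumes "Poly_Mapping.lookup m i > 0"
  shows "m = evar i + (m - evar i)"
  using assms by (intro poly_mapping_eqI) (auto simp: mon_lookup)

lemma monom_deg_alt:
  assumes "finite A" "Poly_Mapping.keys m \<subseteq> A"
  shows "monom_deg m = (\<Sum>i\<in>A. Poly_Mapping.lookup m i)"
  unfolding monom_deg_def
  by (rule sum.mono_neutral_left) (use assms in \<open>auto simp: in_keys_iff\<close>)

lemma monom_deg_add [simp]: "monom_deg (a + b) = monom_deg a + monom_deg b"
proof -
  let ?A = "Poly_Mapping.keys a \<union> Poly_Mapping.keys b"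
  have "monom_deg (a + b) = (\<Sum>i\<in>?A. Poly_Mapping.lookup (a + b) i)"
    by (rule monom_deg_alt) (auto simp: keys_add_nat)
  also have "\<dots> = (\<Sum>i\<in>?A. Poly_Mapping.lookup a i) + (\<Sum>i\<in>?A. Poly_Mapping.lookup b i)"
    by (simp add: lookup_add sum.distrib)
  also have "\<dots> = monom_deg a + monom_deg b"
    by (subst (1 2) monom_deg_alt[of ?A]) auto
  finally show ?thesis .
qed

lemma monom_deg_single [simp]: "monom_deg (Poly_Mapping.single i c) = c"
  by (subst monom_deg_alt[of "{i}"]) auto

lemma monom_deg_evar [simp]: "monom_deg (evar i) = 1"
  by (simp add: evar_def)

lemma monom_deg_0 [simp]: "monom_deg 0 = 0"
  by (simp add: monom_deg_def)

lemma monom_deg_eq_0_iff: "monom_deg m = 0 \<longleftrightarrow> m = 0"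
  by (auto simp: monom_deg_def in_keys_iff intro!: poly_mapping_eqI)

text \<open>Induction on the degree, splitting off one variable at a time. The set \<open>V\<close>
  restricts the variables; \<open>V = UNIV\<close> gives induction over all monomials.\<close>

lemma mon_induct_in [consumes 1, case_names zero add]:
  assumes "Poly_Mapping.keys m \<subseteq> V" and "P 0"
    and "\<And>i m. \<lbrakk>Poly_Mapping.keys m \<subseteq> V; i \<in> V; P m\<rbrakk> \<Longrightarrow> P (evar i + m)"
  shows "P m"
  using assms(1)
proof (induction "monom_deg m" arbitrary: m)
  case 0
  then show ?case using assms(2) by (metis monom_deg_eq_0_iff)
next
  case (Suc k)
  then have "m \<noteq> 0" by auto
  then obtain i where i: "i \<in> Poly_Mapping.keys m" by fastforce
  then have pos: "Poly_Mapping.lookup m i > 0" by (simp add: in_keys_iff)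
  have eq: "m = evar i + (m - evar i)" by (rule evar_factor[OF pos])
  have "monom_deg m = 1 + monom_deg (m - evar i)"
    by (subst eq) (simp only: monom_deg_add monom_deg_evar)
  moreover have "Poly_Mapping.keys (m - evar i) \<subseteq> V"
    using Suc.prems by (auto simp: in_keys_iff mon_lookup)
  ultimately have "P (m - evar i)" using Suc.hyps by auto
  then have "P (evar i + (m - evar i))"
    using assms(3)[of "m - evar i" i] i Suc.prems \<open>Poly_Mapping.keys (m - evar i) \<subseteq> V\<close> by blast
  then show ?case using eq by simp
qed

definition mons :: "nat \<Rightarrow> mon set" where
  "mons n = {m. Poly_Mapping.keys m \<subseteq> {0..n}}"

lemma mons_lookup: "m \<in> mons n \<longleftrightarrow> (\<forall>i>n. Poly_Mapping.lookup m i = 0)"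
  unfolding mons_def in_keys_iff subset_iff by (auto, metis not_le less_irrefl)

lemma mons_add [simp]: "a + b \<in> mons n \<longleftrightarrow> a \<in> mons n \<and> b \<in> mons n"
  by (simp add: mons_def keys_add_nat)

lemma mons_evar [simp]: "evar i \<in> mons n \<longleftrightarrow> i \<le> n"
  by (simp add: mons_def)

lemma mons_single [simp]: "i \<le> n \<Longrightarrow> Poly_Mapping.single i c \<in> mons n"
  by (simp add: mons_def)

lemma mons_0 [simp]: "0 \<in> mons n"
  by (simp add: mons_def)

text \<open>Degree in the first \<open>p\<close> variables only. It measures which power of the last
  of them can be produced by exchanges, see \<open>boi_shift\<close>.\<close>

definition pdeg :: "nat \<Rightarrow> mon \<Rightarrow> nat" where
  "pdeg p m = (\<Sum>i<p. Poly_Mapping.lookup m i)"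

lemma pdeg_add [simp]: "pdeg p (a + b) = pdeg p a + pdeg p b"
  by (simp add: pdeg_def lookup_add sum.distrib)

lemma pdeg_evar [simp]: "pdeg p (evar i) = (if i < p then 1 else 0)"
  by (auto simp: pdeg_def lookup_evar)

lemma pdeg_0 [simp]: "pdeg p 0 = 0"
  by (simp add: pdeg_def)

lemma pdeg_single [simp]: "pdeg p (Poly_Mapping.single i c) = (if i < p then c else 0)"
  by (auto simp: pdeg_def lookup_single_if)

lemma monom_deg_pdeg: "Poly_Mapping.keys m \<subseteq> {..<p} \<Longrightarrow> monom_deg m = pdeg p m"
  unfolding pdeg_def by (rule monom_deg_alt) auto

lemma monom_deg_mons: "m \<in> mons n \<Longrightarrow> monom_deg m = pdeg (Suc n) m"
  by (rule monom_deg_pdeg) (auto simp: mons_def)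

lemma pdeg_le_monom_deg: "pdeg p m \<le> monom_deg m"
proof -
  have "pdeg p m = (\<Sum>i\<in>{..<p} \<inter> Poly_Mapping.keys m. Poly_Mapping.lookup m i)"
    unfolding pdeg_def by (rule sum.mono_neutral_right) (auto simp: in_keys_iff)
  also have "\<dots> \<le> monom_deg m"
    unfolding monom_deg_def by (rule sum_mono2) auto
  finally show ?thesis .
qed

text \<open>Pascal's rule for monomials: either \<open>x\<close> does not occur, or it can be
  divided out.\<close>

lemma monoms_Suc:
  assumes "x \<notin> V"
  shows "{w. Poly_Mapping.keys w \<subseteq> insert x V \<and> monom_deg w = Suc s}
    = {w. Poly_Mapping.keys w \<subseteq> V \<and> monom_deg w = Suc s}
      \<union> (+) (evar x) ` {w. Poly_Mapping.keys w \<subseteq> insert x V \<and> monom_deg w = s}" (is "?L = ?A \<union> ?f ` ?B")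
proof
  show "?L \<subseteq> ?A \<union> ?f ` ?B"
  proof
    fix w assume w: "w \<in> ?L"
    show "w \<in> ?A \<union> ?f ` ?B"
    proof (cases "x \<in> Poly_Mapping.keys w")
      case True
      then have eq: "w = evar x + (w - evar x)" by (intro evar_factor) (simp add: in_keys_iff)
      then have "monom_deg w = 1 + monom_deg (w - evar x)"
        by (metis monom_deg_add monom_deg_evar)
      moreover have "Poly_Mapping.keys (w - evar x) \<subseteq> insert x V"
        using w by (auto simp: in_keys_iff mon_lookup subset_iff)
      ultimately have "w - evar x \<in> ?B" using w by auto
      then show ?thesis using eq by blast
    next
      case False
      then show ?thesis using w by auto
    qed
  qed
  show "?A \<union> ?f ` ?B \<subseteq> ?L" by (auto simp: keys_add_nat)
qed

text \<open>Stars and bars, by a double induction on the set of variables and on the degree;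
  \<open>monoms_Suc\<close> supplies the recursion.\<close>

lemma card_monoms:
  assumes "finite V" "V \<noteq> {}"
  shows "finite {w. Poly_Mapping.keys w \<subseteq> V \<and> monom_deg w = s}
    \<and> card {w. Poly_Mapping.keys w \<subseteq> V \<and> monom_deg w = s} = (s + card V - 1) choose (card V - 1)"
  using assms
proof (induction V arbitrary: s rule: finite_ne_induct)
  case (singleton x)
  have "w = Poly_Mapping.single x s" if "Poly_Mapping.keys w \<subseteq> {x}" "monom_deg w = s" for w
    using that monom_deg_alt[of "{x}" w]
    by (intro poly_mapping_eqI) (auto simp: in_keys_iff subset_iff lookup_single_if)
  then have "{w. Poly_Mapping.keys w \<subseteq> {x} \<and> monom_deg w = s} = {Poly_Mapping.single x s}"
    by (auto split: if_splits)
  then show ?case by simp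
next
  case (insert x V)
  obtain c where c: "card V = Suc c" using insert by (cases "card V") auto
  show ?case
  proof (induction s)
    case 0
    have "{w. Poly_Mapping.keys w \<subseteq> insert x V \<and> monom_deg w = 0} = {0}"
      by (auto simp: monom_deg_eq_0_iff)
    then show ?case using insert by simp
  next
    case (Suc s)
    let ?A = "{w. Poly_Mapping.keys w \<subseteq> V \<and> monom_deg w = Suc s}"
    let ?B = "{w. Poly_Mapping.keys w \<subseteq> insert x V \<and> monom_deg w = s}"
    have inj: "inj_on ((+) (evar x)) ?B" by (auto simp: inj_on_def)
    have disj: "?A \<inter> (+) (evar x) ` ?B = {}"
      using insert.hyps by (auto simp: keys_add_nat)
    have A: "finite ?A" "card ?A = (Suc s + c) choose c"
      using insert.IH[of "Suc s"] c by auto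
    have B: "finite ?B" "card ?B = (s + Suc c) choose (Suc c)"
      using Suc c insert.hyps by auto
    have "finite (?A \<union> (+) (evar x) ` ?B)"
      using A B by blast
    moreover have "card (?A \<union> (+) (evar x) ` ?B) = (Suc s + Suc c) choose (Suc c)"
      using A B disj by (subst card_Un_disjoint) (auto simp: card_image[OF inj])
    ultimately show ?case unfolding monoms_Suc[OF insert.hyps(3)] using c insert.hyps by auto
  qed
qed

definition slice :: "mon set \<Rightarrow> nat \<Rightarrow> mon set" where
  "slice N t = {m \<in> N. monom_deg m = t}"

lemma finite_slice: "N \<subseteq> mons n \<Longrightarrow> finite (slice N t)"
  by (rule finite_subset[of _ "{w. Poly_Mapping.keys w \<subseteq> {0..n} \<and> monom_deg w = t}"])
    (use card_monoms[of "{0..n}" t] in \<open>auto simp: slice_def mons_def\<close>)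

text \<open>If \<open>u\<close> involves only variables below \<open>x_p\<close>, this is the set of
  monomials of \<open>u k[x_p,...,x_n]\<close>. Prescribing exponents instead of products makes
  disjointness of cones a comparison of a single exponent.\<close>

definition cone :: "nat \<Rightarrow> mon \<Rightarrow> nat \<Rightarrow> mon set" where
  "cone n u p = {m \<in> mons n. \<forall>i<p. Poly_Mapping.lookup m i = Poly_Mapping.lookup u i}"

lemma cone_mons: "cone n u p \<subseteq> mons n"
  by (auto simp: cone_def)

lemma cone_altdef:
  assumes "Poly_Mapping.keys u \<subseteq> {..<p}" "p \<le> n"
  shows "cone n u p = (+) u ` {w. Poly_Mapping.keys w \<subseteq> {p..n}}" (is "?L = ?R")
proof
  show "?L \<subseteq> ?R"
  proof
    fix m assume m: "m \<in> ?L"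
    have z: "Poly_Mapping.lookup u i = 0" if "i \<ge> p" for i
      using assms(1) that by (auto simp: in_keys_iff subset_iff)
    have "m = u + (m - u)"
    proof (rule poly_mapping_eqI)
      fix i show "Poly_Mapping.lookup m i = Poly_Mapping.lookup (u + (m - u)) i"
        using m z[of i] by (cases "i < p") (auto simp: cone_def mon_lookup)
    qed
    moreover have "i \<in> {p..n}" if "i \<in> Poly_Mapping.keys (m - u)" for i
    proof -
      have "Poly_Mapping.lookup m i > Poly_Mapping.lookup u i"
        using that by (simp add: in_keys_iff mon_lookup)
      then show ?thesis
        using m by (cases "i < p"; cases "i > n") (auto simp: cone_def mons_lookup)
    qed
    ultimately show "m \<in> ?R" by blast
  qed
  show "?R \<subseteq> ?L"
  proof
    fix m assume "m \<in> ?R"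
    then obtain w where w: "m = u + w" "Poly_Mapping.keys w \<subseteq> {p..n}" by blast
    then have "Poly_Mapping.lookup w i = 0" if "i < p" for i
      using that by (auto simp: in_keys_iff subset_iff)
    moreover have "Poly_Mapping.keys m \<subseteq> {0..n}"
      using w assms by (force simp: keys_add_nat)
    ultimately show "m \<in> ?L" using w by (simp add: cone_def mons_def lookup_add)
  qed
qed

lemma card_cone:
  assumes "Poly_Mapping.keys u \<subseteq> {..<p}" "p \<le> n"
  shows "card (slice (cone n u p) t) =
    (if monom_deg u \<le> t then (t - monom_deg u + (n - p)) choose (n - p) else 0)"
proof (cases "monom_deg u \<le> t")
  case True
  have "slice (cone n u p) t = (+) u ` {w. Poly_Mapping.keys w \<subseteq> {p..n} \<and> monom_deg w = t - monom_deg u}"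
    unfolding cone_altdef[OF assms] slice_def using True by auto
  moreover have "inj_on ((+) u) {w. Poly_Mapping.keys w \<subseteq> {p..n} \<and> monom_deg w = t - monom_deg u}"
    by (auto simp: inj_on_def)
  ultimately show ?thesis
    using True card_monoms[of "{p..n}" "t - monom_deg u"] assms by (simp add: card_image Suc_diff_le)
next
  case False
  then have "slice (cone n u p) t = {}"
    unfolding cone_altdef[OF assms] slice_def by auto
  then show ?thesis using False by simp
qed

section \<open>Monomial ideals attached to Borel order ideals\<close>

text \<open>The standard monomials of a saturated strongly stable ideal. The last closure property is
  saturation: by the exchange property it suffices to test multiplication by \<open>x_n\<close>.\<close>

definition borel_order_ideal :: "nat \<Rightarrow> mon set \<Rightarrow> bool" where
  "borel_order_ideal n N \<longleftrightarrow> N \<subseteq> mons n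
     \<and> (\<forall>m i. evar i + m \<in> N \<longrightarrow> m \<in> N)
     \<and> (\<forall>m i j. evar i + m \<in> N \<longrightarrow> i < j \<longrightarrow> j \<le> n \<longrightarrow> evar j + m \<in> N)
     \<and> (\<forall>m\<in>N. evar n + m \<in> N)"

lemma boi_mons: "borel_order_ideal n N \<Longrightarrow> N \<subseteq> mons n"
  by (simp add: borel_order_ideal_def)

lemma boi_down1: "borel_order_ideal n N \<Longrightarrow> evar i + m \<in> N \<Longrightarrow> m \<in> N"
  unfolding borel_order_ideal_def by blast

lemma boi_swap: "borel_order_ideal n N \<Longrightarrow> evar i + m \<in> N \<Longrightarrow> i \<le> j \<Longrightarrow> j \<le> n \<Longrightarrow> evar j + m \<in> N"
  unfolding borel_order_ideal_def by (metis le_neq_implies_less)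

lemma boi_last1: "borel_order_ideal n N \<Longrightarrow> m \<in> N \<Longrightarrow> evar n + m \<in> N"
  unfolding borel_order_ideal_def by blast

text \<open>Indexed by the standard monomials, so that the Hilbert function of the quotient becomes
  a cardinality of \<open>slice N t\<close>.\<close>

definition monideal :: "nat \<Rightarrow> mon set \<Rightarrow> 'k::comm_ring_1 mpoly set" where
  "monideal n N = {p. Poly_Mapping.keys p \<subseteq> mons n - N}"

lemma Sring_mons: "Sring n = {p. Poly_Mapping.keys p \<subseteq> mons n}"
  by (auto simp: Sring_def mons_def)

lemma monideal_Sring: "monideal n N \<subseteq> Sring n"
  by (auto simp: monideal_def Sring_mons)

lemma monideal_inj:
  assumes "monideal n N = (monideal n N' :: 'k::comm_ring_1 mpoly set)" "N \<subseteq> mons n" "N' \<subseteq> mons n"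
  shows "N = N'"
proof -
  have "m \<in> mons n - A \<longleftrightarrow> (Poly_Mapping.single m 1 :: 'k mpoly) \<in> monideal n A" for m A
    by (simp add: monideal_def)
  then have "mons n - N = mons n - N'" using assms(1) by blast
  then show ?thesis using assms(2,3) by blast
qed

lemma keys_sum_subset:
  assumes "\<And>i. i \<in> I \<Longrightarrow> Poly_Mapping.keys (f i) \<subseteq> S"
  shows "Poly_Mapping.keys (sum f I) \<subseteq> S"
  using keys_sum[of f I] assms by blast

lemma mpoly_decomp: "(p :: 'k::comm_ring_1 mpoly) = (\<Sum>m\<in>Poly_Mapping.keys p. Poly_Mapping.single m (Poly_Mapping.lookup p m))"
proof (rule poly_mapping_eqI)
  fix m
  have "Poly_Mapping.lookup (\<Sum>m\<in>Poly_Mapping.keys p. Poly_Mapping.single m (Poly_Mapping.lookup p m)) m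
      = (\<Sum>m'\<in>Poly_Mapping.keys p. if m' = m then Poly_Mapping.lookup p m' else 0)"
    by (simp add: lookup_sum lookup_single when_def)
  then show "Poly_Mapping.lookup p m = Poly_Mapping.lookup (\<Sum>m\<in>Poly_Mapping.keys p. Poly_Mapping.single m (Poly_Mapping.lookup p m)) m"
    by (auto simp: in_keys_iff)
qed

lemma const_single: "const c * Poly_Mapping.single m d = Poly_Mapping.single m (c * d)"
  by (simp add: const_def mult_single)

lemma const_mult: "const c * const d = const (c * d)"
  by (simp add: const_def mult_single)

lemma const_0 [simp]: "const 0 = 0"
  by (simp add: const_def)

lemma const_1 [simp]: "const 1 = 1"
  by (simp add: const_def)

lemma const_add: "const (c + d) = const c + const d"
  by (simp add: const_def single_add)

lemma lookup_const_mult: "Poly_Mapping.lookup (const c * p) m = c * Poly_Mapping.lookup p m"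
proof -
  have "const c * p = (\<Sum>m\<in>Poly_Mapping.keys p. Poly_Mapping.single m (c * Poly_Mapping.lookup p m))"
    by (subst (1) mpoly_decomp) (simp add: sum_distrib_left const_single)
  then have "Poly_Mapping.lookup (const c * p) m
      = (\<Sum>m'\<in>Poly_Mapping.keys p. if m' = m then c * Poly_Mapping.lookup p m' else 0)"
    by (simp add: lookup_sum lookup_single when_def)
  then show ?thesis by (auto simp: in_keys_iff)
qed

lemma lookup_Var_mult:
  "Poly_Mapping.lookup (Var i * p) \<mu> =
    (if Poly_Mapping.lookup \<mu> i > 0 then Poly_Mapping.lookup p (\<mu> - evar i) else 0)"
proof -
  have "Var i * p = (\<Sum>m\<in>Poly_Mapping.keys p. Poly_Mapping.single (evar i + m) (Poly_Mapping.lookup p m))"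
    by (subst (1) mpoly_decomp) (simp add: sum_distrib_left Var_def mult_single evar_def)
  then have *: "Poly_Mapping.lookup (Var i * p) \<mu>
      = (\<Sum>m\<in>Poly_Mapping.keys p. if evar i + m = \<mu> then Poly_Mapping.lookup p m else 0)"
    by (simp add: lookup_sum lookup_single when_def)
  show ?thesis
  proof (cases "Poly_Mapping.lookup \<mu> i > 0")
    case True
    have "evar i + m = \<mu> \<longleftrightarrow> m = \<mu> - evar i" for m
      using evar_factor[OF True] by (metis add_diff_cancel_left')
    then show ?thesis using True * by (auto simp: in_keys_iff)
  next
    case False
    then have "evar i + m \<noteq> \<mu>" for m by (auto simp: mon_lookup)
    then show ?thesis using False * by simp
  qed
qed

lemma Var_evar: "Var i = Poly_Mapping.single (evar i) 1"
  by (simp add: Var_def evar_def)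

section \<open>Substitutions as ring homomorphisms\<close>

definition msub :: "(nat \<Rightarrow> 'k::comm_ring_1 mpoly) \<Rightarrow> mon \<Rightarrow> 'k mpoly" where
  "msub \<sigma> m = (\<Prod>i\<in>Poly_Mapping.keys m. \<sigma> i ^ Poly_Mapping.lookup m i)"

lemma msub_alt:
  assumes "finite A" "Poly_Mapping.keys m \<subseteq> A"
  shows "msub \<sigma> m = (\<Prod>i\<in>A. \<sigma> i ^ Poly_Mapping.lookup m i)"
  unfolding msub_def by (rule prod.mono_neutral_left) (use assms in \<open>auto simp: in_keys_iff\<close>)

lemma msub_0 [simp]: "msub \<sigma> 0 = 1"
  by (simp add: msub_def)

lemma msub_add: "msub \<sigma> (a + b) = msub \<sigma> a * msub \<sigma> b"
proof -
  let ?A = "Poly_Mapping.keys a \<union> Poly_Mapping.keys b"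
  have "msub \<sigma> (a + b) = (\<Prod>i\<in>?A. \<sigma> i ^ Poly_Mapping.lookup (a + b) i)"
    by (rule msub_alt) (auto simp: keys_add_nat)
  also have "\<dots> = (\<Prod>i\<in>?A. \<sigma> i ^ Poly_Mapping.lookup a i) * (\<Prod>i\<in>?A. \<sigma> i ^ Poly_Mapping.lookup b i)"
    by (simp add: lookup_add power_add prod.distrib)
  also have "\<dots> = msub \<sigma> a * msub \<sigma> b"
    by (subst (1 2) msub_alt[of ?A]) auto
  finally show ?thesis .
qed

lemma msub_evar [simp]: "msub \<sigma> (evar i) = \<sigma> i"
  by (simp add: msub_def lookup_evar)

lemma subst_msub: "subst \<sigma> p = (\<Sum>m\<in>Poly_Mapping.keys p. const (Poly_Mapping.lookup p m) * msub \<sigma> m)"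
  by (simp add: subst_def msub_def)

lemma subst_alt:
  assumes "finite A" "Poly_Mapping.keys p \<subseteq> A"
  shows "subst \<sigma> p = (\<Sum>m\<in>A. const (Poly_Mapping.lookup p m) * msub \<sigma> m)"
  unfolding subst_msub by (rule sum.mono_neutral_left) (use assms in \<open>auto simp: in_keys_iff\<close>)

lemma subst_single: "subst \<sigma> (Poly_Mapping.single m c) = const c * msub \<sigma> m"
  by (subst subst_alt[of "{m}"]) auto

lemma subst_0 [simp]: "subst \<sigma> 0 = 0"
  by (simp add: subst_def)

lemma subst_add: "subst \<sigma> (p + q) = subst \<sigma> p + subst \<sigma> q"
proof -
  let ?A = "Poly_Mapping.keys p \<union> Poly_Mapping.keys q"
  have "subst \<sigma> (p + q) = (\<Sum>m\<in>?A. const (Poly_Mapping.lookup (p + q) m) * msub \<sigma> m)"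
    by (rule subst_alt) (auto simp: Poly_Mapping.keys_add)
  also have "\<dots> = (\<Sum>m\<in>?A. const (Poly_Mapping.lookup p m) * msub \<sigma> m) + (\<Sum>m\<in>?A. const (Poly_Mapping.lookup q m) * msub \<sigma> m)"
    by (simp add: lookup_add const_add distrib_right sum.distrib)
  also have "\<dots> = subst \<sigma> p + subst \<sigma> q"
    by (subst (1 2) subst_alt[of ?A]) auto
  finally show ?thesis .
qed

lemma subst_sum: "subst \<sigma> (sum f A) = (\<Sum>a\<in>A. subst \<sigma> (f a))"
  by (induction A rule: infinite_finite_induct) (auto simp: subst_add)

text \<open>Both sides are bilinear, which reduces the claim to single terms, where it is
  \<open>msub_add\<close>.\<close>

lemma subst_mult: "subst \<sigma> (p * q) = subst \<sigma> p * subst \<sigma> q"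
proof -
  have s: "subst \<sigma> (Poly_Mapping.single a c * Poly_Mapping.single b d)
      = subst \<sigma> (Poly_Mapping.single a c) * subst \<sigma> (Poly_Mapping.single b d)" for a b c d
    by (simp add: mult_single subst_single msub_add const_mult[symmetric] ac_simps)
  have "subst \<sigma> (p * q) = (\<Sum>a\<in>Poly_Mapping.keys p. \<Sum>b\<in>Poly_Mapping.keys q.
      subst \<sigma> (Poly_Mapping.single a (Poly_Mapping.lookup p a) * Poly_Mapping.single b (Poly_Mapping.lookup q b)))"
    by (subst (1) mpoly_decomp[of p], subst (1) mpoly_decomp[of q]) (simp add: sum_product subst_sum)
  also have "\<dots> = (\<Sum>a\<in>Poly_Mapping.keys p. subst \<sigma> (Poly_Mapping.single a (Poly_Mapping.lookup p a)))
     * (\<Sum>b\<in>Poly_Mapping.keys q. subst \<sigma> (Poly_Mapping.single b (Poly_Mapping.lookup q b)))"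
    by (simp only: s sum_product)
  also have "\<dots> = subst \<sigma> p * subst \<sigma> q"
    by (simp only: subst_sum[symmetric] mpoly_decomp[symmetric])
  finally show ?thesis .
qed

lemma subst_const [simp]: "subst \<sigma> (const c) = const c"
  unfolding const_def[of c] subst_single by (simp add: const_def)

lemma subst_Var [simp]: "subst \<sigma> (Var i) = \<sigma> i"
  by (simp add: Var_evar subst_single)

lemma subst_diff: "subst \<sigma> (p - q) = subst \<sigma> p - subst \<sigma> q"
  using subst_add[of \<sigma> "p - q" q] by (simp add: algebra_simps)

lemma subst_one [simp]: "subst \<sigma> 1 = 1"
  using subst_const[of \<sigma> 1] by simp

lemma subst_power: "subst \<sigma> (p ^ k) = subst \<sigma> p ^ k"
  by (induction k) (auto simp: subst_mult)

lemma subst_prod: "subst \<sigma> (prod f A) = (\<Prod>a\<in>A. subst \<sigma> (f a))"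
  by (induction A rule: infinite_finite_induct) (auto simp: subst_mult)

text \<open>The composite is again multiplicative and fixes every variable up to \<open>x_n\<close>,
  hence fixes every monomial of \<open>S\<close>.\<close>

lemma subst_subst:
  assumes "p \<in> Sring n" "\<And>i. i \<le> n \<Longrightarrow> subst \<sigma> (\<tau> i) = Var i"
  shows "subst \<sigma> (subst \<tau> p) = p"
proof -
  have V: "msub \<sigma> m = Poly_Mapping.single m 1" if "m \<in> mons n" "\<And>i. i \<le> n \<Longrightarrow> \<sigma> i = Var i"
    for m and \<sigma> :: "nat \<Rightarrow> 'a mpoly"
  proof -
    have "Poly_Mapping.keys m \<subseteq> {0..n}" using that by (simp add: mons_def)
    then show ?thesis
      by (induction rule: mon_induct_in) (auto simp: msub_add that Var_evar mult_single)
  qed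
  have "subst \<sigma> (msub \<tau> m) = Poly_Mapping.single m 1" if "m \<in> mons n" for m
    using V[of m "\<lambda>i. subst \<sigma> (\<tau> i)"] that assms(2)
    by (simp add: msub_def subst_prod subst_power)
  then have "subst \<sigma> (subst \<tau> p) = (\<Sum>m\<in>Poly_Mapping.keys p. Poly_Mapping.single m (Poly_Mapping.lookup p m))"
    unfolding subst_msub[of \<tau>] subst_sum
    by (intro sum.cong) (use assms(1) in \<open>auto simp: Sring_mons subst_mult const_single\<close>)
  then show ?thesis using mpoly_decomp[of p] by simp
qed

lemma keys_const_mult: "Poly_Mapping.keys (const c * p) \<subseteq> Poly_Mapping.keys p"
  by (auto simp: in_keys_iff lookup_const_mult)

section \<open>Invariance under triangular substitutions\<close>

text \<open>Replacing \<open>x_i\<close> by some \<open>x_j\<close> with \<open>j <= i\<close>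
  cannot leave the complement of \<open>N\<close>, by the contrapositive of the exchange property.
  The extra factor \<open>w\<close> holds the part of the product outside the current induction,
  since the exchange needs the full monomial.\<close>

lemma keys_msub_lower:
  assumes boi: "borel_order_ideal n N"
    and \<sigma>: "\<And>i. i \<le> n \<Longrightarrow> Poly_Mapping.keys (\<sigma> i) \<subseteq> evar ` {..i}"
    and "m \<in> mons n" "w + m \<in> mons n - N" "\<mu> \<in> Poly_Mapping.keys (msub \<sigma> m)"
  shows "w + \<mu> \<in> mons n - N"
proof -
  have "Poly_Mapping.keys m \<subseteq> {0..n}" using assms(3) by (simp add: mons_def)
  then show ?thesis using assms(4,5)
  proof (induction arbitrary: w \<mu> rule: mon_induct_in)
    case zero
    then show ?case by simp
  next
    case (add i m)
    from add.prems(2) obtain \<alpha> \<mu>' where "\<alpha> \<in> Poly_Mapping.keys (\<sigma> i)"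
      and \<mu>': "\<mu>' \<in> Poly_Mapping.keys (msub \<sigma> m)" and eq: "\<mu> = \<alpha> + \<mu>'"
      using keys_mult[of "\<sigma> i" "msub \<sigma> m"] by (auto simp: msub_add)
    then obtain j where j: "\<alpha> = evar j" "j \<le> i" using \<sigma>[of i] add.hyps(2) by auto
    have "(evar i + w) + m \<in> mons n - N" using add.prems(1) by (simp add: ac_simps)
    from add.IH[OF this \<mu>'] have "evar i + (w + \<mu>') \<in> mons n - N" by (simp add: ac_simps)
    then have "evar j + (w + \<mu>') \<in> mons n - N"
      using boi_swap[OF boi, of j "w + \<mu>'" i] j add.hyps(2) by auto
    then show ?case by (simp add: eq j ac_simps)
  qed
qed

lemma subst_lower_monideal:
  assumes boi: "borel_order_ideal n N"
    and \<sigma>: "\<And>i. i \<le> n \<Longrightarrow> Poly_Mapping.keys (\<sigma> i) \<subseteq> evar ` {..i}"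
    and "p \<in> monideal n N"
  shows "subst \<sigma> p \<in> monideal n N"
proof -
  have "Poly_Mapping.keys (const (Poly_Mapping.lookup p m) * msub \<sigma> m) \<subseteq> mons n - N"
    if "m \<in> Poly_Mapping.keys p" for m
  proof
    fix \<mu> assume "\<mu> \<in> Poly_Mapping.keys (const (Poly_Mapping.lookup p m) * msub \<sigma> m)"
    then have "\<mu> \<in> Poly_Mapping.keys (msub \<sigma> m)" using keys_const_mult by blast
    then show "\<mu> \<in> mons n - N"
      using keys_msub_lower[OF boi \<sigma>, of m 0 \<mu>] that assms(3) by (auto simp: monideal_def)
  qed
  then have "Poly_Mapping.keys (subst \<sigma> p) \<subseteq> mons n - N"
    unfolding subst_msub by (rule keys_sum_subset)
  then show ?thesis by (simp add: monideal_def)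
qed

lemma keys_linear_form: "Poly_Mapping.keys (\<Sum>j\<in>J. const (c j) * Var j :: 'k::comm_ring_1 mpoly) \<subseteq> evar ` {j \<in> J. c j \<noteq> 0}"
proof -
  have "Poly_Mapping.keys (const (c j) * Var j :: 'k mpoly) \<subseteq> (if c j = 0 then {} else {evar j})" for j
    by (auto simp: Var_evar const_single)
  then have "Poly_Mapping.keys (const (c j) * Var j :: 'k mpoly) \<subseteq> evar ` {j \<in> J. c j \<noteq> 0}" if "j \<in> J" for j
    using that by (smt (verit) empty_subsetI image_eqI insert_subset mem_Collect_eq subset_trans)
  then show ?thesis by (rule keys_sum_subset)
qed

text \<open>Forward substitution: \<open>x_i\<close> is sent to a combination of \<open>x_j\<close>
  with \<open>j <= i\<close> whose coefficient at \<open>x_i\<close> is nonzero, and preimages of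
  the earlier variables are known by induction.\<close>

lemma upper_tri_inverse:
  fixes A :: "nat \<Rightarrow> nat \<Rightarrow> 'k::field"
  assumes A: "upper_tri_inv n A"
  shows "i \<le> n \<Longrightarrow> \<exists>t. Poly_Mapping.keys t \<subseteq> evar ` {..i} \<and> borel_act n A t = Var i"
proof (induction i rule: less_induct)
  case (less i)
  then have "\<forall>j. \<exists>t. j < i \<longrightarrow> Poly_Mapping.keys t \<subseteq> evar ` {..j} \<and> borel_act n A t = Var j"
    by (meson le_trans less_imp_le)
  then obtain \<tau> where \<tau>: "\<And>j. j < i \<Longrightarrow> Poly_Mapping.keys (\<tau> j) \<subseteq> evar ` {..j}"
      "\<And>j. j < i \<Longrightarrow> borel_act n A (\<tau> j) = Var j"
    by metis
  define t where "t = const (1 / A i i) * (Var i - (\<Sum>j<i. const (A j i) * \<tau> j))"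
  have "Poly_Mapping.keys (\<Sum>j<i. const (A j i) * \<tau> j) \<subseteq> evar ` {..i}"
  proof -
    have "Poly_Mapping.keys (const (A j i) * \<tau> j) \<subseteq> evar ` {..i}" if "j < i" for j
    proof -
      have "evar ` {..j} \<subseteq> evar ` {..i}" using that by (intro image_mono) auto
      then show ?thesis using keys_const_mult[of "A j i" "\<tau> j"] \<tau>(1)[OF that] by blast
    qed
    then show ?thesis by (intro keys_sum_subset) auto
  qed
  then have "Poly_Mapping.keys (Var i - (\<Sum>j<i. const (A j i) * \<tau> j)) \<subseteq> evar ` {..i}"
    using keys_diff[of "Var i" "\<Sum>j<i. const (A j i) * \<tau> j"] by (auto simp: Var_evar)
  then have 1: "Poly_Mapping.keys t \<subseteq> evar ` {..i}"
    unfolding t_def using keys_const_mult by blast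
  have "(\<Sum>j=0..n. const (A j i) * Var j) = (\<Sum>j\<in>{..<i} \<union> {i}. const (A j i) * Var j)"
    by (rule sum.mono_neutral_right) (use A less.prems in \<open>auto simp: upper_tri_inv_def\<close>)
  then have "(\<Sum>j=0..n. const (A j i) * Var j) = (\<Sum>j<i. const (A j i) * Var j) + const (A i i) * Var i"
    by (subst (asm) sum.union_disjoint) auto
  then have "borel_act n A t = const (1 / A i i) * (const (A i i) * Var i)"
    using \<tau>(2) by (simp add: t_def borel_act_def subst_mult subst_diff subst_sum)
  also have "\<dots> = Var i"
    using A less.prems by (simp add: mult.assoc[symmetric] const_mult upper_tri_inv_def)
  finally show ?case using 1 by blast
qed

lemma borel_fixed_monideal:
  fixes N :: "mon set"
  assumes boi: "borel_order_ideal n N"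
  shows "borel_fixed n (monideal n N :: 'k::field mpoly set)"
  unfolding borel_fixed_def
proof (intro allI impI)
  fix A :: "nat \<Rightarrow> nat \<Rightarrow> 'k" assume A: "upper_tri_inv n A"
  have 1: "Poly_Mapping.keys (\<Sum>j=0..n. const (A j i) * Var j) \<subseteq> evar ` {..i}" if "i \<le> n" for i
  proof -
    have "j \<le> i" if "j \<in> {0..n}" "A j i \<noteq> 0" for j
      using A that \<open>i \<le> n\<close> unfolding upper_tri_inv_def by (metis atLeastAtMost_iff not_le)
    then have "evar ` {j \<in> {0..n}. A j i \<noteq> 0} \<subseteq> evar ` {..i}" by blast
    then show ?thesis using keys_linear_form[of "\<lambda>j. A j i" "{0..n}"] by (rule order.trans[rotated])
  qed
  \<comment> \<open>Stability alone gives only an inclusion. Preimages of the variables define a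
    second substitution of the same triangular shape, which yields preimages inside the
    ideal.\<close>
  have "\<forall>i. \<exists>t. i \<le> n \<longrightarrow> Poly_Mapping.keys t \<subseteq> evar ` {..i} \<and> borel_act n A t = Var i"
    using upper_tri_inverse[OF A] by blast
  then obtain \<tau> where \<tau>: "\<And>i. i \<le> n \<Longrightarrow> Poly_Mapping.keys (\<tau> i) \<subseteq> evar ` {..i}"
      "\<And>i. i \<le> n \<Longrightarrow> borel_act n A (\<tau> i) = Var i"
    by metis
  show "borel_act n A ` monideal n N = monideal n N"
  proof
    show "borel_act n A ` monideal n N \<subseteq> monideal n N"
      unfolding borel_act_def using subst_lower_monideal[OF boi 1] by blast
    show "monideal n N \<subseteq> borel_act n A ` monideal n N"
    proof
      fix p :: "'k mpoly" assume p: "p \<in> monideal n N"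
      have "borel_act n A (subst \<tau> p) = p"
        using subst_subst[of p n "\<lambda>i. \<Sum>j=0..n. const (A j i) * Var j" \<tau>] p monideal_Sring \<tau>(2)
        unfolding borel_act_def by blast
      moreover have "subst \<tau> p \<in> monideal n N" by (rule subst_lower_monideal[OF boi \<tau>(1) p])
      ultimately show "p \<in> borel_act n A ` monideal n N" by force
    qed
  qed
qed

lemma boi_down:
  assumes boi: "borel_order_ideal n N" and "w + m \<in> N"
  shows "m \<in> N"
proof -
  have "Poly_Mapping.keys w \<subseteq> UNIV" by simp
  then show ?thesis using assms(2)
    by (induction rule: mon_induct_in) (auto simp: add.assoc dest: boi_down1[OF boi])
qed

lemma is_ideal_monideal:
  assumes boi: "borel_order_ideal n N"
  shows "is_ideal n (monideal n N :: 'k::comm_ring_1 mpoly set)"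
  unfolding is_ideal_def
proof (intro conjI ballI)
  show "monideal n N \<subseteq> (Sring n :: 'k mpoly set)" by (rule monideal_Sring)
  show "(0 :: 'k mpoly) \<in> monideal n N" by (simp add: monideal_def)
next
  fix f g :: "'k mpoly" assume "f \<in> monideal n N" "g \<in> monideal n N"
  then show "f + g \<in> monideal n N" using Poly_Mapping.keys_add[of f g] by (auto simp: monideal_def)
next
  fix f g :: "'k mpoly" assume f: "f \<in> monideal n N" and g: "g \<in> Sring n"
  then show "g * f \<in> monideal n N"
    using keys_mult[of g f] boi_down[OF boi] by (fastforce simp: monideal_def Sring_mons)
qed

lemma lookup_hcomp: "Poly_Mapping.lookup (hcomp t p) m = (if monom_deg m = t then Poly_Mapping.lookup p m else 0)"
proof -
  have "finite {m. (if monom_deg m = t then Poly_Mapping.lookup p m else 0) \<noteq> 0}"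
    by (rule finite_subset[of _ "Poly_Mapping.keys p"]) (auto simp: in_keys_iff)
  then show ?thesis unfolding hcomp_def by (simp add: lookup_Abs_poly_mapping)
qed

lemma homogeneous_monideal:
  assumes "borel_order_ideal n N"
  shows "homogeneous_ideal n (monideal n N)"
  unfolding homogeneous_ideal_def
  using is_ideal_monideal[OF assms]
  by (auto simp: monideal_def in_keys_iff lookup_hcomp subset_iff)

lemma lookup_single_mult_add:
  "Poly_Mapping.lookup (Poly_Mapping.single a 1 * p) (a + m) = Poly_Mapping.lookup (p :: 'k::comm_ring_1 mpoly) m"
proof -
  have "Poly_Mapping.single a 1 * p = (\<Sum>m\<in>Poly_Mapping.keys p. Poly_Mapping.single (a + m) (Poly_Mapping.lookup p m))"
    by (subst (1) mpoly_decomp) (simp add: sum_distrib_left mult_single)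
  then show ?thesis
    by (auto simp: lookup_sum lookup_single when_def in_keys_iff)
qed

text \<open>It suffices to test one monomial of degree \<open>k\<close>, namely
  \<open>x_n^k\<close>: multiplication by it keeps standard monomials standard, so it cannot push a
  standard term of \<open>f\<close> into the ideal.\<close>

lemma saturated_monideal:
  assumes boi: "borel_order_ideal n N"
  shows "saturated n (monideal n N :: 'k::comm_ring_1 mpoly set)"
  unfolding saturated_def
proof (intro ballI impI)
  fix f :: "'k mpoly" assume f: "f \<in> Sring n"
    and "\<exists>k. \<forall>\<mu>. Poly_Mapping.keys \<mu> \<subseteq> {0..n} \<and> monom_deg \<mu> = k \<longrightarrow> Poly_Mapping.single \<mu> 1 * f \<in> monideal n N"
  then obtain k where "\<And>\<mu>. Poly_Mapping.keys \<mu> \<subseteq> {0..n} \<Longrightarrow> monom_deg \<mu> = k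
      \<Longrightarrow> Poly_Mapping.single \<mu> 1 * f \<in> monideal n N"
    by blast
  then have k: "Poly_Mapping.single (Poly_Mapping.single n k) 1 * f \<in> monideal n N"
    by (simp add: mons_single[unfolded mons_def])
  have last: "Poly_Mapping.single n k + m \<in> N" if "m \<in> N" for m
    by (induction k) (use that in \<open>auto simp: single_Suc add.assoc intro: boi_last1[OF boi]\<close>)
  show "f \<in> monideal n N"
    unfolding monideal_def
  proof (safe)
    fix m assume m: "m \<in> Poly_Mapping.keys f"
    then show "m \<in> mons n" using f by (auto simp: Sring_mons)
    assume "m \<in> N"
    from last[OF this] show False
      using k m by (auto simp: monideal_def in_keys_iff subset_iff lookup_single_mult_add)
  qed
qed

section \<open>Hilbert function of a monomial ideal\<close>

interpretation mpoly_vs: vector_space "\<lambda>c (p :: 'k::field mpoly). const c * p"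
  by unfold_locales (auto simp: distrib_left distrib_right const_add const_mult[symmetric] mult.assoc)

text \<open>Projecting degree \<open>t\<close> forms to their standard part has kernel exactly the
  degree \<open>t\<close> part of the ideal. So independence modulo the ideal becomes ordinary
  independence in the span of the standard monomials, and those monomials themselves attain the
  bound.\<close>

lemma hilb_fun_monideal:
  fixes N :: "mon set"
  assumes N: "N \<subseteq> mons n"
  shows "hilb_fun n (monideal n N :: 'k::field mpoly set) t = card (slice N t)"
proof -
  let ?I = "monideal n N :: 'k mpoly set"
  let ?mono = "\<lambda>m. Poly_Mapping.single m 1 :: 'k mpoly"
  have fin: "finite (slice N t)" by (rule finite_slice[OF N])
  have upper: "card B \<le> card (slice N t)"
    if B: "finite B" "B \<subseteq> homog n t" "lin_indep_mod ?I B" for B :: "'k mpoly set"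
  proof -
    define \<phi> :: "'k mpoly \<Rightarrow> 'k mpoly" where
      "\<phi> b = (\<Sum>m\<in>slice N t. Poly_Mapping.single m (Poly_Mapping.lookup b m))" for b
    have lk: "Poly_Mapping.lookup (\<phi> b) m = (if m \<in> slice N t then Poly_Mapping.lookup b m else 0)" for b m
      unfolding \<phi>_def using fin by (simp add: lookup_sum lookup_single when_def)
    have key: "\<forall>b\<in>B. c b = 0" if "(\<Sum>b\<in>B. const (c b) * \<phi> b) = 0" for c
    proof -
      have "m \<in> mons n - N" if "m \<in> Poly_Mapping.keys (\<Sum>b\<in>B. const (c b) * b)" for m
      proof -
        from that obtain b where b: "b \<in> B" "m \<in> Poly_Mapping.keys b"
          using keys_sum[of "\<lambda>b. const (c b) * b" B] keys_const_mult by blast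
        then have m: "m \<in> mons n" "monom_deg m = t" using B(2) by (auto simp: homog_def Sring_mons)
        have "m \<notin> N"
        proof
          assume "m \<in> N"
          then have "m \<in> slice N t" using m by (simp add: slice_def)
          then have "Poly_Mapping.lookup (\<Sum>b\<in>B. const (c b) * b) m = Poly_Mapping.lookup (\<Sum>b\<in>B. const (c b) * \<phi> b) m"
            by (simp add: lookup_sum lookup_const_mult lk)
          with \<open>(\<Sum>b\<in>B. const (c b) * \<phi> b) = 0\<close> that show False by (simp add: in_keys_iff)
        qed
        with m show ?thesis by blast
      qed
      then have "(\<Sum>b\<in>B. const (c b) * b) \<in> ?I" by (auto simp: monideal_def)
      with B(3) show ?thesis by (auto simp: lin_indep_mod_def)
    qed
    have inj: "inj_on \<phi> B"
    proof (rule inj_onI, rule ccontr)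
      fix x y assume xy: "x \<in> B" "y \<in> B" "\<phi> x = \<phi> y" "x \<noteq> y"
      \<comment> \<open>Two elements of \<open>B\<close> with equal projection would give the
        relation \<open>x - y\<close> modulo the ideal.\<close>
      let ?c = "\<lambda>b. if b = x then 1 else if b = y then -1 else 0 :: 'k"
      have "(\<Sum>b\<in>B. const (?c b) * \<phi> b) = (\<Sum>b\<in>{x, y}. const (?c b) * \<phi> b)"
        by (rule sum.mono_neutral_right) (use xy B in auto)
      also have "\<dots> = \<phi> x + const (-1) * \<phi> y" using xy by simp
      also have "\<dots> = 0" using xy(3) by (auto intro!: poly_mapping_eqI simp: lookup_add lookup_const_mult)
      finally show False using key[of ?c] xy by auto
    qed
    have "\<not> mpoly_vs.dependent (\<phi> ` B)"
    proof
      assume "mpoly_vs.dependent (\<phi> ` B)"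
      then obtain u where u: "\<exists>v\<in>\<phi> ` B. u v \<noteq> 0" "(\<Sum>v\<in>\<phi> ` B. const (u v) * v) = 0"
        using B(1) by (subst (asm) mpoly_vs.dependent_finite) auto
      from u(2) have "(\<Sum>b\<in>B. const (u (\<phi> b)) * \<phi> b) = 0"
        by (subst (asm) sum.reindex[OF inj]) simp
      from key[OF this] u(1) show False by auto
    qed
    moreover have "\<phi> ` B \<subseteq> mpoly_vs.span (?mono ` slice N t)"
    proof -
      have "Poly_Mapping.single m c \<in> mpoly_vs.span (?mono ` slice N t)" if "m \<in> slice N t" for m c
        using mpoly_vs.span_scale[OF mpoly_vs.span_base[of "?mono m" "?mono ` slice N t"], of c] that
        by (auto simp: const_single)
      then show ?thesis unfolding \<phi>_def by (auto intro!: mpoly_vs.span_sum)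
    qed
    ultimately have "card (\<phi> ` B) \<le> card (?mono ` slice N t)"
      using mpoly_vs.independent_span_bound[of "?mono ` slice N t" "\<phi> ` B"] fin by auto
    also have "\<dots> \<le> card (slice N t)" by (rule card_image_le[OF fin])
    finally show ?thesis using inj by (simp add: card_image)
  qed
  have inj: "inj_on ?mono (slice N t)"
    by (rule inj_onI) (metis keys_single singleton_inject zero_neq_one)
  have "lin_indep_mod ?I (?mono ` slice N t)"
    unfolding lin_indep_mod_def
  proof (intro allI impI ballI)
    fix c b assume I: "(\<Sum>b\<in>?mono ` slice N t. const (c b) * b) \<in> ?I" and "b \<in> ?mono ` slice N t"
    then obtain m where m: "m \<in> slice N t" "b = ?mono m" by blast
    have "(\<Sum>b\<in>?mono ` slice N t. const (c b) * b) = (\<Sum>m\<in>slice N t. Poly_Mapping.single m (c (?mono m)))"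
      by (subst sum.reindex[OF inj]) (simp add: const_single)
    then have "Poly_Mapping.lookup (\<Sum>b\<in>?mono ` slice N t. const (c b) * b) m = c b"
      using m fin by (simp add: lookup_sum lookup_single when_def)
    moreover have "m \<notin> Poly_Mapping.keys (\<Sum>b\<in>?mono ` slice N t. const (c b) * b)"
      using I m by (auto simp: monideal_def slice_def)
    ultimately show "c b = 0" by (simp add: in_keys_iff)
  qed
  moreover have "?mono ` slice N t \<subseteq> homog n t"
    using N by (auto simp: homog_def Sring_mons slice_def)
  ultimately have mem: "card (slice N t) \<in> {card B | B. finite B \<and> B \<subseteq> homog n t \<and> lin_indep_mod ?I B}"
    using fin card_image[OF inj] by (metis (mono_tags, lifting) finite_imageI mem_Collect_eq)
  have "finite {card B | B. finite B \<and> B \<subseteq> homog n t \<and> lin_indep_mod ?I B}"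
    by (rule finite_subset[of _ "{..card (slice N t)}"]) (use upper in auto)
  then show ?thesis
    unfolding hilb_fun_def by (rule Max_eqI) (use upper mem in auto)
qed

section \<open>Borel fixed ideals are monomial\<close>

lemma is_ideal_add: "is_ideal n I \<Longrightarrow> f \<in> I \<Longrightarrow> g \<in> I \<Longrightarrow> f + g \<in> I"
  and is_ideal_mult: "is_ideal n I \<Longrightarrow> f \<in> I \<Longrightarrow> h \<in> Sring n \<Longrightarrow> h * f \<in> I"
  and is_ideal_0: "is_ideal n I \<Longrightarrow> 0 \<in> I"
  and is_ideal_Sring: "is_ideal n I \<Longrightarrow> I \<subseteq> Sring n"
  by (auto simp: is_ideal_def)

lemma const_Sring [simp]: "const c \<in> Sring n"
  by (auto simp: const_def Sring_mons)

lemma is_ideal_const: "is_ideal n I \<Longrightarrow> f \<in> I \<Longrightarrow> const c * f \<in> I"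
  by (rule is_ideal_mult) auto

lemma is_ideal_diff:
  assumes "is_ideal n I" "f \<in> I" "g \<in> I"
  shows "f - g \<in> I"
proof -
  have "f - g = f + const (-1) * g"
    by (rule poly_mapping_eqI) (simp add: lookup_add lookup_minus lookup_const_mult)
  then show ?thesis using assms is_ideal_add is_ideal_const by metis
qed

lemma is_ideal_sum: "is_ideal n I \<Longrightarrow> (\<And>a. a \<in> A \<Longrightarrow> f a \<in> I) \<Longrightarrow> sum f A \<in> I"
  by (induction A rule: infinite_finite_induct) (auto simp: is_ideal_0 is_ideal_add)

text \<open>The diagonal matrix with entry \<open>c\<close> in place \<open>i\<close> scales each
  monomial by a character. Varying \<open>i\<close> separates all monomials.\<close>

lemma lookup_torus_act:
  fixes p :: "'k::field mpoly"
  assumes "p \<in> Sring n"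
  shows "Poly_Mapping.lookup (borel_act n (\<lambda>a b. if a = b then (if a = i then c else 1) else 0) p) m
    = Poly_Mapping.lookup p m * c ^ Poly_Mapping.lookup m i"
proof -
  define \<sigma> :: "nat \<Rightarrow> 'k mpoly" where
    "\<sigma> = (\<lambda>l. \<Sum>j=0..n. const (if j = l then (if j = i then c else 1) else 0) * Var j)"
  have \<sigma>: "\<sigma> l = Poly_Mapping.single (evar l) (if l = i then c else 1)" if "l \<le> n" for l
  proof -
    have "\<sigma> l = (\<Sum>j=0..n. if j = l then const (if j = i then c else 1) * Var j else 0)"
      unfolding \<sigma>_def by (rule sum.cong) auto
    also have "\<dots> = const (if l = i then c else 1) * Var l" using that by simp
    finally show ?thesis by (simp add: Var_evar const_single)
  qed
  have ms: "msub \<sigma> m = Poly_Mapping.single m (c ^ Poly_Mapping.lookup m i)" if "m \<in> mons n" for m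
  proof -
    have "Poly_Mapping.keys m \<subseteq> {0..n}" using that by (simp add: mons_def)
    then show ?thesis
      by (induction rule: mon_induct_in) (auto simp: msub_add \<sigma> mult_single lookup_add lookup_evar)
  qed
  have "borel_act n (\<lambda>a b. if a = b then (if a = i then c else 1) else 0) p = subst \<sigma> p"
    by (simp add: borel_act_def \<sigma>_def)
  also have "\<dots> = (\<Sum>m\<in>Poly_Mapping.keys p. Poly_Mapping.single m (Poly_Mapping.lookup p m * c ^ Poly_Mapping.lookup m i))"
    unfolding subst_msub
    by (rule sum.cong) (use assms in \<open>auto simp: Sring_mons ms const_single\<close>)
  finally show ?thesis
    by (auto simp: lookup_sum lookup_single when_def in_keys_iff)
qed

text \<open>Torus weights separate the terms: as long as \<open>f\<close> has a second monomial
  \<open>m'\<close>, a diagonal matrix produces an element of \<open>I\<close> with fewer terms that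
  still contains \<open>m\<close>.\<close>

lemma borel_fixed_monomials:
  fixes I :: "'k::field_char_0 mpoly set"
  assumes I: "is_ideal n I" and fixed: "borel_fixed n I"
  shows "f \<in> I \<Longrightarrow> m \<in> Poly_Mapping.keys f \<Longrightarrow> Poly_Mapping.single m 1 \<in> I"
proof (induction "card (Poly_Mapping.keys f)" arbitrary: f m rule: less_induct)
  case less
  have fS: "f \<in> Sring n" using less.prems is_ideal_Sring[OF I] by blast
  show ?case
  proof (cases "Poly_Mapping.keys f = {m}")
    case True
    have "f = Poly_Mapping.single m (Poly_Mapping.lookup f m)"
      by (subst mpoly_decomp) (simp add: True)
    then have "const (1 / Poly_Mapping.lookup f m) * f = Poly_Mapping.single m 1"
      by (metis const_single in_keys_iff less.prems(2) nonzero_eq_divide_eq)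
    then show ?thesis using is_ideal_const[OF I less.prems(1)] by metis
  next
    case False
    then obtain m' where m': "m' \<in> Poly_Mapping.keys f" "m' \<noteq> m" using less.prems(2) by blast
    then obtain i where i: "Poly_Mapping.lookup m i \<noteq> Poly_Mapping.lookup m' i"
      by (metis poly_mapping_eqI)
    let ?e = "Poly_Mapping.lookup m' i"
    let ?A = "\<lambda>a b. if a = b then (if a = i then 2 else 1) else 0 :: 'k"
    \<comment> \<open>Subtracting the eigenvalue of \<open>m'\<close> cancels the term at
      \<open>m'\<close>; the term at \<open>m\<close> survives because the powers of 2 are distinct
      in characteristic 0.\<close>
    define g where "g = borel_act n ?A f - const (2 ^ ?e) * f"
    have lg: "Poly_Mapping.lookup g \<mu> = Poly_Mapping.lookup f \<mu> * (2 ^ Poly_Mapping.lookup \<mu> i - 2 ^ ?e)" for \<mu>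
      by (simp add: g_def lookup_minus lookup_const_mult lookup_torus_act[OF fS] right_diff_distrib)
    have "upper_tri_inv n ?A" by (auto simp: upper_tri_inv_def)
    then have "borel_act n ?A f \<in> I" using fixed less.prems(1) unfolding borel_fixed_def by blast
    then have gI: "g \<in> I" unfolding g_def using is_ideal_diff[OF I] is_ideal_const[OF I] less.prems(1) by blast
    have "Poly_Mapping.keys g \<subseteq> Poly_Mapping.keys f - {m'}"
      by (auto simp: in_keys_iff lg)
    then have "card (Poly_Mapping.keys g) < card (Poly_Mapping.keys f)"
      using m' by (intro psubset_card_mono) auto
    moreover have "(2 :: 'k) ^ Poly_Mapping.lookup m i \<noteq> 2 ^ ?e"
    proof -
      have "(2 :: nat) ^ Poly_Mapping.lookup m i \<noteq> 2 ^ ?e" using i by simp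
      then show ?thesis by (metis of_nat_eq_iff of_nat_numeral of_nat_power)
    qed
    then have "m \<in> Poly_Mapping.keys g" using less.prems(2) by (simp add: in_keys_iff lg)
    ultimately show ?thesis using less.hyps gI by blast
  qed
qed

text \<open>The elementary unipotent matrix with entry 1 at \<open>(i, j)\<close> sends
  \<open>x_j\<close> to \<open>x_i + x_j\<close>. The image of \<open>x_j m\<close> contains
  \<open>x_i m\<close> with a positive integer coefficient, nonzero in characteristic 0, and
  \<open>borel_fixed_monomials\<close> extracts this term.\<close>

lemma borel_fixed_exchange:
  fixes I :: "'k::field_char_0 mpoly set"
  assumes I: "is_ideal n I" and fixed: "borel_fixed n I"
    and ij: "i < j" "j \<le> n" and m: "Poly_Mapping.single (evar j + m) 1 \<in> I"
  shows "Poly_Mapping.single (evar i + m) 1 \<in> I"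
proof -
  define \<sigma> :: "nat \<Rightarrow> 'k mpoly" where
    "\<sigma> = (\<lambda>l. \<Sum>a=0..n. const (if a = l \<or> (a = i \<and> l = j) then 1 else 0) * Var a)"
  have \<sigma>: "\<sigma> l = (if l = j then Var i + Var j else Var l)" if "l \<le> n" for l
  proof -
    have "\<sigma> l = (\<Sum>a\<in>{0..n} \<inter> {a. a = l \<or> (a = i \<and> l = j)}. Var a)"
      unfolding \<sigma>_def by (subst sum.inter_restrict) (auto intro!: sum.cong)
    also have "{0..n} \<inter> {a. a = l \<or> (a = i \<and> l = j)} = (if l = j then {i, j} else {l})"
      using that ij by auto
    finally show ?thesis using ij by auto
  qed
  have mS: "evar j + m \<in> mons n" using m is_ideal_Sring[OF I] by (auto simp: Sring_mons)
  then have "Poly_Mapping.keys m \<subseteq> {0..n}" by (simp add: mons_def keys_add_nat)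
  \<comment> \<open>All coefficients are natural numbers, so the wanted one cannot cancel.\<close>
  then have nat: "(\<forall>\<mu>. \<exists>k. Poly_Mapping.lookup (msub \<sigma> m) \<mu> = of_nat k)
      \<and> (\<exists>k. Poly_Mapping.lookup (msub \<sigma> m) m = of_nat (Suc k))"
  proof (induction rule: mon_induct_in)
    case zero
    show ?case by (auto simp: lookup_one when_def intro: exI[of _ 0] exI[of _ 1])
  next
    case (add l m)
    have V: "\<exists>k. Poly_Mapping.lookup (Var a * msub \<sigma> m) \<mu> = of_nat k" for a \<mu>
      using add.IH by (auto simp: lookup_Var_mult intro: exI[of _ 0])
    have S: "\<exists>k. Poly_Mapping.lookup (Var l * msub \<sigma> m) (evar l + m) = of_nat (Suc k)"
      using add.IH by (auto simp: lookup_Var_mult lookup_add lookup_evar)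
    show ?case
    proof (cases "l = j")
      case True
      then have eq: "msub \<sigma> (evar l + m) = Var i * msub \<sigma> m + Var l * msub \<sigma> m"
        using ij by (simp add: msub_add \<sigma> distrib_right)
      show ?thesis
        unfolding eq lookup_add by (metis S V add_Suc_right of_nat_add)
    next
      case False
      then have eq: "msub \<sigma> (evar l + m) = Var l * msub \<sigma> m"
        using add.hyps by (simp add: msub_add \<sigma>)
      show ?thesis unfolding eq using S V by blast
    qed
  qed
  have "msub \<sigma> (evar j + m) = Var i * msub \<sigma> m + Var j * msub \<sigma> m"
    using ij by (simp add: msub_add \<sigma> distrib_right)
  moreover obtain k where "Poly_Mapping.lookup (Var i * msub \<sigma> m) (evar i + m) = of_nat (Suc k)"
    using nat by (auto simp: lookup_Var_mult lookup_add lookup_evar)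
  moreover obtain k' where "Poly_Mapping.lookup (Var j * msub \<sigma> m) (evar i + m) = of_nat k'"
    using nat by (metis lookup_Var_mult of_nat_0)
  ultimately have "Poly_Mapping.lookup (msub \<sigma> (evar j + m)) (evar i + m) = of_nat (Suc (k + k'))"
    by (simp add: lookup_add)
  then have key: "evar i + m \<in> Poly_Mapping.keys (msub \<sigma> (evar j + m))"
    by (metis in_keys_iff of_nat_neq_0)
  let ?A = "\<lambda>a b. if a = b \<or> (a = i \<and> b = j) then 1 else 0 :: 'k"
  have "borel_act n ?A (Poly_Mapping.single (evar j + m) 1) = msub \<sigma> (evar j + m)"
    by (simp add: borel_act_def \<sigma>_def subst_single)
  moreover have "upper_tri_inv n ?A" using ij by (auto simp: upper_tri_inv_def)
  moreover from \<open>upper_tri_inv n ?A\<close> have "borel_act n ?A ` I = I"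
    using fixed unfolding borel_fixed_def by blast
  ultimately have "msub \<sigma> (evar j + m) \<in> I"
    using imageI[OF m, of "borel_act n ?A"] by simp
  then show ?thesis using borel_fixed_monomials[OF I fixed] key by blast
qed

text \<open>The link between saturation and closure under \<open>x_n\<close>: if
  \<open>x_n m\<close> lies in \<open>I\<close>, exchanges put every \<open>x_i m\<close> into
  \<open>I\<close>, so \<open>m\<close> is killed by the irrelevant ideal modulo \<open>I\<close>
  and saturation gives \<open>m\<close> in \<open>I\<close>.\<close>

lemma borel_fixed_saturated_obtain:
  fixes I :: "'k::field_char_0 mpoly set"
  assumes I: "is_ideal n I" and sat: "saturated n I" and fixed: "borel_fixed n I"
  obtains N where "borel_order_ideal n N" "I = monideal n N"
proof
  define N where "N = {m \<in> mons n. Poly_Mapping.single m (1 :: 'k) \<notin> I}"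
  have mult: "Poly_Mapping.single (a + m) (1 :: 'k) \<in> I" if "Poly_Mapping.single m (1 :: 'k) \<in> I" "a \<in> mons n" for a m
    using is_ideal_mult[OF I that(1), of "Poly_Mapping.single a 1"] that(2) by (auto simp: mult_single Sring_mons)
  show "borel_order_ideal n N"
    unfolding borel_order_ideal_def
  proof (intro conjI allI impI ballI)
    show "N \<subseteq> mons n" by (auto simp: N_def)
  next
    fix m i assume "evar i + m \<in> N"
    then show "m \<in> N" using mult[of m "evar i"] by (auto simp: N_def)
  next
    fix m i j assume "evar i + m \<in> N" "i < j" "j \<le> n"
    then show "evar j + m \<in> N" using borel_fixed_exchange[OF I fixed, of i j m] by (auto simp: N_def)
  next
    fix m assume m: "m \<in> N"
    show "evar n + m \<in> N"
    proof (rule ccontr)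
      assume "evar n + m \<notin> N"
      then have n: "Poly_Mapping.single (evar n + m) (1 :: 'k) \<in> I" using m by (simp add: N_def)
      have all: "Poly_Mapping.single (evar i + m) (1 :: 'k) \<in> I" if "i \<le> n" for i
        using borel_fixed_exchange[OF I fixed _ _ n, of i] n that by (cases "i = n") auto
      \<comment> \<open>Exponent 1 suffices in the definition of saturation.\<close>
      have "Poly_Mapping.single \<mu> 1 * Poly_Mapping.single m (1 :: 'k) \<in> I"
        if "Poly_Mapping.keys \<mu> \<subseteq> {0..n}" "monom_deg \<mu> = 1" for \<mu>
      proof -
        have "\<mu> \<noteq> 0" using that by auto
        then obtain i where i: "i \<in> Poly_Mapping.keys \<mu>" by fastforce
        then have eq: "\<mu> = evar i + (\<mu> - evar i)" by (intro evar_factor) (simp add: in_keys_iff)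
        then have "monom_deg \<mu> = 1 + monom_deg (\<mu> - evar i)" by (metis monom_deg_add monom_deg_evar)
        then have "\<mu> = evar i" using eq that by (simp add: monom_deg_eq_0_iff)
        then show ?thesis using all[of i] i that by (auto simp: mult_single)
      qed
      then have "\<exists>k. \<forall>\<mu>. Poly_Mapping.keys \<mu> \<subseteq> {0..n} \<and> monom_deg \<mu> = k
          \<longrightarrow> Poly_Mapping.single \<mu> 1 * Poly_Mapping.single m (1 :: 'k) \<in> I" by blast
      moreover have "Poly_Mapping.single m (1 :: 'k) \<in> Sring n" using m by (simp add: N_def Sring_mons)
      ultimately have "Poly_Mapping.single m (1 :: 'k) \<in> I"
        using sat unfolding saturated_def by blast
      then show False using m by (simp add: N_def)
    qed
  qed
  show "I = monideal n N"
  proof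
    show "I \<subseteq> monideal n N"
      using borel_fixed_monomials[OF I fixed] is_ideal_Sring[OF I]
      by (auto simp: monideal_def N_def Sring_mons)
    show "monideal n N \<subseteq> I"
    proof
      fix f :: "'k mpoly" assume f: "f \<in> monideal n N"
      have "Poly_Mapping.single m (Poly_Mapping.lookup f m) \<in> I" if "m \<in> Poly_Mapping.keys f" for m
        using is_ideal_const[OF I, of "Poly_Mapping.single m 1" "Poly_Mapping.lookup f m"] f that
        by (auto simp: monideal_def N_def const_single)
      then show "f \<in> I" by (subst mpoly_decomp) (rule is_ideal_sum[OF I])
    qed
  qed
qed

section \<open>From ideals to counting order ideals\<close>

definition has_count :: "(nat \<Rightarrow> int) \<Rightarrow> mon set \<Rightarrow> bool" where
  "has_count P N \<longleftrightarrow> (\<exists>t0. \<forall>t\<ge>t0. int (card (slice N t)) = P t)"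

text \<open>After this bridge the classification of Borel fixed points is purely
  combinatorial.\<close>

theorem hilb_borel_points_eq:
  "(hilb_borel_points n P :: 'k::field_char_0 mpoly set set)
    = monideal n ` {N. borel_order_ideal n N \<and> has_count P N}"
proof -
  have hp: "has_hilb_poly n (monideal n N :: 'k mpoly set) P \<longleftrightarrow> has_count P N" if "borel_order_ideal n N" for N
    by (simp add: has_hilb_poly_def has_count_def hilb_fun_monideal[OF boi_mons[OF that]])
  show ?thesis
  proof (intro set_eqI iffI)
    fix I :: "'k mpoly set" assume I: "I \<in> hilb_borel_points n P"
    then obtain N where N: "borel_order_ideal n N" "I = monideal n N"
      using borel_fixed_saturated_obtain[of n I] by (auto simp: hilb_borel_points_def homogeneous_ideal_def)
    then show "I \<in> monideal n ` {N. borel_order_ideal n N \<and> has_count P N}"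
      using I hp by (auto simp: hilb_borel_points_def)
  next
    fix I :: "'k mpoly set" assume "I \<in> monideal n ` {N. borel_order_ideal n N \<and> has_count P N}"
    then show "I \<in> hilb_borel_points n P"
      by (auto simp: hilb_borel_points_def hp homogeneous_monideal saturated_monideal borel_fixed_monideal)
  qed
qed

lemma gen_ideal_monomials:
  assumes M: "M \<subseteq> mons n"
  shows "gen_ideal n ((\<lambda>m. Poly_Mapping.single m 1) ` M)
    = (monideal n {m \<in> mons n. \<forall>g\<in>M. \<forall>w. m \<noteq> w + g} :: 'k::comm_ring_1 mpoly set)" (is "?L = monideal n ?N")
proof
  show "?L \<subseteq> monideal n ?N"
  proof
    fix p :: "'k mpoly" assume "p \<in> ?L"
    then obtain F and c :: "'k mpoly \<Rightarrow> 'k mpoly" where F: "F \<subseteq> (\<lambda>m. Poly_Mapping.single m 1) ` M" "\<forall>g\<in>F. c g \<in> Sring n"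
        "p = (\<Sum>g\<in>F. c g * g)" by (auto simp: gen_ideal_def)
    have "Poly_Mapping.keys (c b * b) \<subseteq> mons n - ?N" if b: "b \<in> F" for b
    proof
      fix \<mu> assume "\<mu> \<in> Poly_Mapping.keys (c b * b)"
      moreover obtain g where g: "g \<in> M" "b = Poly_Mapping.single g 1" using F(1) b by blast
      ultimately obtain w where "w \<in> Poly_Mapping.keys (c b)" "\<mu> = w + g"
        using keys_mult[of "c b" b] by auto
      then show "\<mu> \<in> mons n - ?N" using F(2) b g M by (auto simp: Sring_mons)
    qed
    then have "Poly_Mapping.keys p \<subseteq> mons n - ?N" unfolding F(3) by (rule keys_sum_subset)
    then show "p \<in> monideal n ?N" by (simp add: monideal_def)
  qed
  show "monideal n ?N \<subseteq> ?L"
  proof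
    fix p :: "'k mpoly" assume "p \<in> monideal n ?N"
    then have "\<forall>m. \<exists>g w. m \<in> Poly_Mapping.keys p \<longrightarrow> m \<in> mons n \<and> g \<in> M \<and> m = w + g"
      unfolding monideal_def by blast
    then obtain g w where gw: "\<And>m. m \<in> Poly_Mapping.keys p \<Longrightarrow> m \<in> mons n \<and> g m \<in> M \<and> m = w m + g m"
      by metis
    define b where "b m = Poly_Mapping.single (g m) (1 :: 'k)" for m
    \<comment> \<open>\<open>gen_ideal\<close> allows one coefficient per generator, so the
      cofactors of all monomials of \<open>p\<close> that were assigned the same generator are
      collected.\<close>
    define c where "c y = (\<Sum>m\<in>{m \<in> Poly_Mapping.keys p. b m = y}. Poly_Mapping.single (w m) (Poly_Mapping.lookup p m))" for y
    have "p = (\<Sum>m\<in>Poly_Mapping.keys p. Poly_Mapping.single (w m) (Poly_Mapping.lookup p m) * b m)"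
      by (subst mpoly_decomp, rule sum.cong) (use gw in \<open>auto simp: b_def mult_single\<close>)
    also have "\<dots> = (\<Sum>y\<in>b ` Poly_Mapping.keys p. \<Sum>m\<in>{m \<in> Poly_Mapping.keys p. b m = y}.
        Poly_Mapping.single (w m) (Poly_Mapping.lookup p m) * b m)"
      by (rule sum.image_gen) simp
    also have "\<dots> = (\<Sum>y\<in>b ` Poly_Mapping.keys p. c y * y)"
      unfolding c_def sum_distrib_right by (intro sum.cong) auto
    finally have "p = (\<Sum>y\<in>b ` Poly_Mapping.keys p. c y * y)" .
    moreover have "c y \<in> Sring n" for y
    proof -
      have "w m \<in> mons n" if "m \<in> Poly_Mapping.keys p" for m
        using gw[OF that] by (metis mons_add)
      then
      have "Poly_Mapping.keys (c y) \<subseteq> mons n"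
        unfolding c_def
        by (intro keys_sum_subset) (auto split: if_splits)
      then show ?thesis by (simp add: Sring_mons)
    qed
    moreover have "b ` Poly_Mapping.keys p \<subseteq> (\<lambda>m. Poly_Mapping.single m 1) ` M"
      using gw by (auto simp: b_def)
    ultimately show "p \<in> ?L" unfolding gen_ideal_def
      by (intro CollectI exI[of _ "b ` Poly_Mapping.keys p"] exI[of _ c]) auto
  qed
qed

section \<open>Order ideals as unions of cones\<close>

text \<open>Factors of \<open>v\<close> with index at most \<open>p\<close> are exchanged for
  \<open>x_p\<close>, all others are divided out. Read contrapositively, it bounds a partial degree
  as soon as some power of \<open>x_p\<close> times \<open>w\<close> is nonstandard.\<close>

lemma boi_shift:
  assumes boi: "borel_order_ideal n N" and "p \<le> n" and "w + v \<in> N" "K \<le> pdeg (Suc p) v"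
  shows "Poly_Mapping.single p K + w \<in> N"
proof -
  have "Poly_Mapping.keys v \<subseteq> UNIV" by simp
  then show ?thesis using assms(3,4)
  proof (induction arbitrary: w K rule: mon_induct_in)
    case zero
    then show ?case by simp
  next
    case (add i v)
    have in_N: "evar i + (w + v) \<in> N" using add.prems(1) by (simp add: ac_simps)
    show ?case
    proof (cases "i \<le> p \<and> K > 0")
      case True
      then obtain K' where K: "K = Suc K'" by (cases K) auto
      have "evar p + (w + v) \<in> N" using boi_swap[OF boi in_N] True \<open>p \<le> n\<close> by simp
      then have "(evar p + w) + v \<in> N" by (simp add: ac_simps)
      from add.IH[OF this, of K'] show ?thesis using add.prems(2) True K by (simp add: single_Suc ac_simps)
    next
      case False
      have "w + v \<in> N" using boi_down1[OF boi in_N] .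
      from add.IH[OF this, of K] show ?thesis using add.prems(2) False by (auto split: if_splits)
    qed
  qed
qed

text \<open>Counterpart of \<open>boi_shift\<close>: the factors of a power of \<open>x_p\<close>
  are exchanged one by one for the variables of \<open>w\<close>, all of index at least
  \<open>p\<close>.\<close>

lemma boi_spread:
  assumes boi: "borel_order_ideal n N" and "Poly_Mapping.keys w \<subseteq> {p..n}"
    and "Poly_Mapping.single p (monom_deg w) + u \<in> N"
  shows "u + w \<in> N"
  using assms(2,3)
proof (induction arbitrary: u rule: mon_induct_in)
  case zero
  then show ?case by simp
next
  case (add i w)
  have "evar p + (Poly_Mapping.single p (monom_deg w) + u) \<in> N"
    using add.prems by (simp add: single_Suc ac_simps)
  then have "evar i + (Poly_Mapping.single p (monom_deg w) + u) \<in> N"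
    by (rule boi_swap[OF boi]) (use add.hyps in auto)
  then have "Poly_Mapping.single p (monom_deg w) + (evar i + u) \<in> N" by (simp add: ac_simps)
  from add.IH[OF this] show ?case by (simp add: ac_simps)
qed

lemma cone_subset_boi:
  assumes boi: "borel_order_ideal n N" and "Poly_Mapping.keys u \<subseteq> {..<p}" "p \<le> n"
    and "\<And>K. Poly_Mapping.single p K + u \<in> N"
  shows "cone n u p \<subseteq> N"
  unfolding cone_altdef[OF assms(2,3)] using boi_spread[OF boi] assms(4) by blast

lemma boi_last:
  assumes "borel_order_ideal n N" "m \<in> N"
  shows "Poly_Mapping.single n s + m \<in> N"
  by (induction s) (use assms in \<open>auto simp: single_Suc add.assoc intro: boi_last1\<close>)

lemma boi_Un: "borel_order_ideal n A \<Longrightarrow> borel_order_ideal n B \<Longrightarrow> borel_order_ideal n (A \<union> B)"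
  unfolding borel_order_ideal_def by blast

text \<open>A monomial of low degree is moved into a degree where the slices agree by multiplying
  with a power of \<open>x_n\<close>, and recovered there by division.\<close>

lemma boi_eqI:
  assumes N: "borel_order_ideal n N" and N': "borel_order_ideal n N'" and "N' \<subseteq> N"
    and "\<And>t. t \<ge> t0 \<Longrightarrow> card (slice N t) \<le> card (slice N' t)"
  shows "N = N'"
proof
  show "N \<subseteq> N'"
  proof
    fix m assume "m \<in> N"
    define t where "t = t0 + monom_deg m"
    have "slice N' t = slice N t"
      using assms(3) assms(4)[of t] finite_slice[OF boi_mons[OF N]]
      by (intro card_seteq) (auto simp: slice_def t_def)
    moreover have "Poly_Mapping.single n t0 + m \<in> slice N t"
      using boi_last[OF N \<open>m \<in> N\<close>] by (simp add: slice_def t_def)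
    ultimately have "Poly_Mapping.single n t0 + m \<in> slice N' t" by blast
    then have "Poly_Mapping.single n t0 + m \<in> N'" by (simp add: slice_def)
    then show "m \<in> N'" using boi_down[OF N'] by blast
  qed
qed (rule assms(3))

lemma pdeg_two:
  assumes "i < p" "j < p" "i \<noteq> j"
  shows "Poly_Mapping.lookup m i + Poly_Mapping.lookup m j \<le> pdeg p m"
proof -
  have "(\<Sum>l\<in>{i, j}. Poly_Mapping.lookup m l) \<le> pdeg p m"
    unfolding pdeg_def by (rule sum_mono2) (use assms in auto)
  then show ?thesis using assms by simp
qed

lemma pdeg_one: "i < p \<Longrightarrow> Poly_Mapping.lookup m i \<le> pdeg p m"
  unfolding pdeg_def by (rule member_le_sum) auto

lemma slice_Un: "slice (A \<union> B) t = slice A t \<union> slice B t"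
  by (auto simp: slice_def)

lemma card_slice_Un:
  assumes "A \<inter> B = {}" "A \<subseteq> mons n" "B \<subseteq> mons n"
  shows "card (slice (A \<union> B) t) = card (slice A t) + card (slice B t)"
  unfolding slice_Un
  by (rule card_Un_disjoint) (use assms finite_slice in \<open>auto simp: slice_def\<close>)

lemma card_slice_UN:
  assumes "finite F" "\<And>u v. u \<in> F \<Longrightarrow> v \<in> F \<Longrightarrow> u \<noteq> v \<Longrightarrow> A u \<inter> A v = {}" "\<And>u. u \<in> F \<Longrightarrow> A u \<subseteq> mons n"
  shows "card (slice (\<Union>u\<in>F. A u) t) = (\<Sum>u\<in>F. card (slice (A u) t))"
proof -
  have "slice (\<Union>u\<in>F. A u) t = (\<Union>u\<in>F. slice (A u) t)" by (auto simp: slice_def)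
  moreover have "card (\<Union>u\<in>F. slice (A u) t) = (\<Sum>u\<in>F. card (slice (A u) t))"
  proof (rule card_UN_disjoint)
    show "\<forall>u\<in>F. finite (slice (A u) t)" using assms(3) finite_slice by blast
    show "\<forall>u\<in>F. \<forall>v\<in>F. u \<noteq> v \<longrightarrow> slice (A u) t \<inter> slice (A v) t = {}"
      using assms(2) unfolding slice_def by blast
  qed (rule assms(1))
  ultimately show ?thesis by simp
qed

lemma cone_disjoint:
  assumes "i < p" "i < p'" "Poly_Mapping.lookup u i \<noteq> Poly_Mapping.lookup v i"
  shows "cone n u p \<inter> cone n v p' = {}"
  using assms by (auto simp: cone_def)

text \<open>Standard monomials of \<open>(x_0,...,x_{k-1}, x_k^a)\<close>, the \<open>a\<close>-fold
  linear space inside a space of one dimension more.\<close>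

definition powers_cone :: "nat \<Rightarrow> nat \<Rightarrow> nat \<Rightarrow> mon set" where
  "powers_cone n k a = {m \<in> mons n. (\<forall>i<k. Poly_Mapping.lookup m i = 0) \<and> Poly_Mapping.lookup m k < a}"

lemma powers_cone_mons: "powers_cone n k a \<subseteq> mons n"
  by (auto simp: powers_cone_def)

lemma powers_cone_UN: "powers_cone n k a = (\<Union>i<a. cone n (Poly_Mapping.single k i) (Suc k))"
  by (auto simp: powers_cone_def cone_def lookup_single_if less_Suc_eq)

lemma card_powers_cone:
  assumes "k < n" "a \<le> t"
  shows "card (slice (powers_cone n k a) t) = (\<Sum>i<a. (t - i + (n - Suc k)) choose (n - Suc k))"
proof -
  have inj: "inj_on (Poly_Mapping.single k) {..<a}" by (rule inj_onI) (metis lookup_single_eq)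
  have "powers_cone n k a = (\<Union>u\<in>Poly_Mapping.single k ` {..<a}. cone n u (Suc k))"
    by (auto simp: powers_cone_UN)
  also have "card (slice \<dots> t) = (\<Sum>u\<in>Poly_Mapping.single k ` {..<a}. card (slice (cone n u (Suc k)) t))"
    by (rule card_slice_UN) (auto simp: cone_def)
  also have "\<dots> = (\<Sum>i<a. card (slice (cone n (Poly_Mapping.single k i) (Suc k)) t))"
    by (simp add: sum.reindex[OF inj])
  also have "\<dots> = (\<Sum>i<a. (t - i + (n - Suc k)) choose (n - Suc k))"
    using assms by (intro sum.cong) (auto simp: card_cone)
  finally show ?thesis .
qed

lemma boi_powers_cone:
  assumes "k < n"
  shows "borel_order_ideal n (powers_cone n k a)"
  unfolding borel_order_ideal_def
  using assms by (auto simp: powers_cone_def lookup_add lookup_evar split: if_splits)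

text \<open>Standard monomials of \<open>(x_0,...,x_{l-1}) + (x_l,...,x_{p-1})^2\<close>. The cone
  \<open>x_l k[x_p,...,x_n]\<close> is not closed under exchange; this larger set is, and its other
  monomials will lie in the sets it is united with.\<close>

definition lin_std :: "nat \<Rightarrow> nat \<Rightarrow> nat \<Rightarrow> mon set" where
  "lin_std n l p = {m \<in> mons n. (\<forall>i<l. Poly_Mapping.lookup m i = 0) \<and> pdeg p m \<le> 1}"

lemma boi_lin_std:
  assumes "p \<le> n" "l \<le> n"
  shows "borel_order_ideal n (lin_std n l p)"
  unfolding borel_order_ideal_def
  using assms by (auto simp: lin_std_def lookup_add lookup_evar split: if_splits)

section \<open>The expanded and the lexicographic point\<close>

text \<open>In terms of the paper, \<open>l = n-d-2\<close>, \<open>k = n-d-1\<close>, \<open>q = n-r\<close> and \<open>p = n-r-1\<close>. The set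
  \<open>plane_std\<close> is the part common to both points.\<close>

definition plane_std :: "nat \<Rightarrow> nat \<Rightarrow> nat \<Rightarrow> nat \<Rightarrow> mon set" where
  "plane_std n k a q = powers_cone n k a \<union> cone n (Poly_Mapping.single k a) q"

definition exp_std :: "nat \<Rightarrow> nat \<Rightarrow> nat \<Rightarrow> nat \<Rightarrow> mon set" where
  "exp_std n l a q = plane_std n (Suc l) a q \<union> cone n (evar l) n"

definition lex_std :: "nat \<Rightarrow> nat \<Rightarrow> nat \<Rightarrow> nat \<Rightarrow> mon set" where
  "lex_std n k a p = plane_std n k a (Suc p) \<union> cone n (evar p + Poly_Mapping.single k a) n"

lemma plane_std_mons: "plane_std n k a q \<subseteq> mons n"
  by (auto simp: plane_std_def powers_cone_def cone_def)

lemma mem_plane_std: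
  assumes "k < q"
  shows "m \<in> plane_std n k a q \<longleftrightarrow> m \<in> mons n \<and> (\<forall>i<k. Poly_Mapping.lookup m i = 0)
    \<and> (Poly_Mapping.lookup m k < a \<or> Poly_Mapping.lookup m k = a \<and> (\<forall>i. k < i \<longrightarrow> i < q \<longrightarrow> Poly_Mapping.lookup m i = 0))"
    (is "?L = ?R")
proof
  show "?L \<Longrightarrow> ?R"
    using assms by (auto simp: plane_std_def powers_cone_def cone_def lookup_single_if)
  assume ?R
  moreover have "\<forall>i<q. Poly_Mapping.lookup m i = (if k = i then a else 0)"
    if "\<forall>i<k. Poly_Mapping.lookup m i = 0" "Poly_Mapping.lookup m k = a" "\<forall>i. k < i \<longrightarrow> i < q \<longrightarrow> Poly_Mapping.lookup m i = 0"
    using that by (metis linorder_neqE_nat)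
  ultimately show ?L
    by (auto simp: plane_std_def powers_cone_def cone_def lookup_single_if)
qed

lemma boi_plane_std:
  assumes "k < q" "q \<le> n"
  shows "borel_order_ideal n (plane_std n k a q)"
  unfolding borel_order_ideal_def
proof (intro conjI allI impI ballI)
  show "plane_std n k a q \<subseteq> mons n" by (rule plane_std_mons)
next
  fix m i assume "evar i + m \<in> plane_std n k a q"
  then show "m \<in> plane_std n k a q"
    by (auto simp: mem_plane_std[OF assms(1)] lookup_add lookup_evar split: if_splits)
next
  fix m i j assume m: "evar i + m \<in> plane_std n k a q" and ij: "i < j" "j \<le> n"
  from m have "i \<ge> k"
    by (auto simp: mem_plane_std[OF assms(1)] lookup_add lookup_evar not_less[symmetric])
  moreover have "q \<le> i" if "i \<noteq> k" "Poly_Mapping.lookup m k = a"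
  proof -
    have "Poly_Mapping.lookup (evar i + m) i \<noteq> 0" "Poly_Mapping.lookup (evar i + m) k = a"
      using that by (auto simp: lookup_add lookup_evar)
    then show ?thesis using m \<open>k \<le> i\<close> that(1) unfolding mem_plane_std[OF assms(1)]
      by (meson le_neq_implies_less less_irrefl not_le)
  qed
  ultimately show "evar j + m \<in> plane_std n k a q"
    using m ij
    by (cases "i = k") (auto simp: mem_plane_std[OF assms(1)] lookup_add lookup_evar split: if_splits)
next
  fix m assume "m \<in> plane_std n k a q"
  then show "evar n + m \<in> plane_std n k a q"
    using assms less_le_trans[OF assms] by (auto simp: mem_plane_std[OF assms(1)] lookup_add lookup_evar)
qed

lemma card_plane_std:
  assumes "k < q" "q \<le> n" "a \<le> t"
  shows "card (slice (plane_std n k a q) t) =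
    (\<Sum>i<a. (t - i + (n - Suc k)) choose (n - Suc k)) + ((t - a + (n - q)) choose (n - q))"
proof -
  have "powers_cone n k a \<inter> cone n (Poly_Mapping.single k a) q = {}"
    using assms by (auto simp: powers_cone_def cone_def lookup_single_if)
  then show ?thesis
    unfolding plane_std_def
    using assms by (subst card_slice_Un[OF _ powers_cone_mons cone_mons]) (simp_all add: card_powers_cone card_cone)
qed

lemma pdeg_cone: "m \<in> cone n u p \<Longrightarrow> pdeg p m = pdeg p u"
  by (simp add: pdeg_def cone_def)

lemma cone_last_eq:
  assumes "p \<le> n" and "m \<in> mons n" and "pdeg p m \<le> 1" "i < p" "Poly_Mapping.lookup m i > 0"
  shows "m \<in> cone n (evar i) p"
proof -
  have "Poly_Mapping.lookup m j = (if i = j then 1 else 0)" if "j < p" for j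
  proof (cases "i = j")
    case True
    then show ?thesis using assms pdeg_one[of j p m] that by simp
  next
    case False
    then show ?thesis using assms pdeg_two[of i p j m] that by simp
  qed
  then show ?thesis using assms(2) by (simp add: cone_def lookup_evar)
qed

text \<open>A monomial of \<open>lin_std\<close> without \<open>x_l\<close> has exponent at most 1
  at \<open>x_{l+1}\<close>, which is below \<open>a\<close>. So \<open>lin_std\<close> contributes
  nothing new except the cone over \<open>x_l\<close>.\<close>

lemma powers_cone_lin_std:
  assumes "Suc l < p" "p \<le> n" "2 \<le> a"
  shows "powers_cone n (Suc l) a \<union> lin_std n l p = powers_cone n (Suc l) a \<union> cone n (evar l) p"
proof -
  have "m \<in> powers_cone n (Suc l) a \<or> m \<in> cone n (evar l) p" if m: "m \<in> lin_std n l p" for m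
  proof (cases "Poly_Mapping.lookup m l = 0")
    case True
    then show ?thesis
      using m pdeg_one[of "Suc l" p m] assms by (auto simp: lin_std_def powers_cone_def less_Suc_eq)
  next
    case False
    then show ?thesis
      using m cone_last_eq[of p n m l] assms by (auto simp: lin_std_def)
  qed
  moreover have "cone n (evar l) p \<subseteq> lin_std n l p"
    using assms pdeg_cone by (auto simp: lin_std_def) (auto simp: cone_def lookup_evar)
  ultimately show ?thesis by blast
qed

text \<open>As in \<open>powers_cone_lin_std\<close>, but \<open>a = 1\<close> is included: if
  \<open>x_{l+1}\<close> occurs, no other variable before \<open>x_n\<close> does, and the monomial
  lies in the residual cone. The union form yields Borel closure at once.\<close>

lemma exp_std_altdef:
  assumes "Suc l < q" "q \<le> n" "1 \<le> a"
  shows "exp_std n l a q = plane_std n (Suc l) a q \<union> lin_std n l n"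
proof -
  have "m \<in> plane_std n (Suc l) a q \<or> m \<in> cone n (evar l) n" if m: "m \<in> lin_std n l n" for m
  proof (cases "Poly_Mapping.lookup m l = 0")
    case True
    have k: "Poly_Mapping.lookup m (Suc l) + Poly_Mapping.lookup m i \<le> 1" if "i > Suc l" "i < n" for i
      using pdeg_two[of "Suc l" n i m] that assms m by (auto simp: lin_std_def)
    then show ?thesis
      using m True pdeg_one[of "Suc l" n m] assms
      by (auto simp: lin_std_def mem_plane_std less_Suc_eq_le le_less)
  next
    case False
    then show ?thesis
      using m cone_last_eq[of n n m l] assms by (auto simp: lin_std_def)
  qed
  moreover have "cone n (evar l) n \<subseteq> lin_std n l n"
    using assms pdeg_cone by (auto simp: lin_std_def) (auto simp: cone_def lookup_evar)
  ultimately show ?thesis unfolding exp_std_def by blast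
qed

lemma boi_exp_std:
  assumes "Suc l < q" "q \<le> n" "1 \<le> a"
  shows "borel_order_ideal n (exp_std n l a q)"
  unfolding exp_std_altdef[OF assms]
  using assms by (intro boi_Un boi_plane_std boi_lin_std) auto

lemma mem_cone_lex:
  assumes "k < p" "p < n"
  shows "m \<in> cone n (evar p + Poly_Mapping.single k a) n \<longleftrightarrow> m \<in> mons n \<and> Poly_Mapping.lookup m k = a
    \<and> Poly_Mapping.lookup m p = 1 \<and> (\<forall>i<n. i \<noteq> k \<longrightarrow> i \<noteq> p \<longrightarrow> Poly_Mapping.lookup m i = 0)"
  using assms by (auto simp: cone_def lookup_add lookup_evar lookup_single_if)

text \<open>Only moves out of the cone \<open>x_k^a x_p k[x_n]\<close> need care. Raising
  \<open>x_k\<close> drops its exponent below \<open>a\<close>; raising or dividing out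
  \<open>x_p\<close> leaves \<open>x_k^a\<close> times variables after \<open>x_p\<close>. Both land
  in \<open>plane_std\<close>.\<close>

lemma boi_lex_std:
  assumes "k < p" "p < n"
  shows "borel_order_ideal n (lex_std n k a p)"
  unfolding borel_order_ideal_def
proof (intro conjI allI impI ballI)
  have kp: "k < Suc p" using assms by simp
  note mem = lex_std_def mem_plane_std[OF kp] mem_cone_lex[OF assms] Un_iff
  note boi = boi_plane_std[OF kp, of n a]
  show "lex_std n k a p \<subseteq> mons n" unfolding lex_std_def using plane_std_mons cone_mons by blast
  {
    fix m i assume "evar i + m \<in> lex_std n k a p"
    then consider "evar i + m \<in> plane_std n k a (Suc p)" | "evar i + m \<in> cone n (evar p + Poly_Mapping.single k a) n"
      unfolding lex_std_def by blast
    then show "m \<in> lex_std n k a p"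
    proof cases
      case 1
      then show ?thesis using boi_down1[OF boi] assms unfolding lex_std_def by auto
    next
      case 2
      show ?thesis
      proof (cases "i = p")
        case True
        with 2 assms have "Poly_Mapping.lookup m l = 0" if "l \<noteq> k" "l < n" for l
          using that unfolding mem by (cases "l = p") (auto simp: lookup_add lookup_evar)
        with True 2 assms show ?thesis
          unfolding mem by (auto simp: lookup_add lookup_evar split: if_splits)
      next
        case False
        with 2 assms show ?thesis
          unfolding mem
          by (cases "i = k"; cases "i < n") (auto simp: lookup_add lookup_evar split: if_splits)
      qed
    qed
  next
    fix m i j assume "evar i + m \<in> lex_std n k a p" and ij: "i < j" "j \<le> n"
    then consider "evar i + m \<in> plane_std n k a (Suc p)" | "evar i + m \<in> cone n (evar p + Poly_Mapping.single k a) n"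
      unfolding lex_std_def by blast
    then show "evar j + m \<in> lex_std n k a p"
    proof cases
      case 1
      then show ?thesis using boi_swap[OF boi] ij assms unfolding lex_std_def by auto
    next
      case 2
      have "i < n" using ij by simp
      with 2 have "i = k \<or> i = p"
        unfolding mem by (auto simp: lookup_add lookup_evar split: if_splits)
      then show ?thesis
      proof
        assume "i = k"
        with 2 ij assms show ?thesis unfolding mem
          by (auto simp: lookup_add lookup_evar split: if_splits)
      next
        assume i: "i = p"
        with 2 assms have "Poly_Mapping.lookup m l = 0" if "l \<noteq> k" "l < n" for l
          using that unfolding mem by (cases "l = p") (auto simp: lookup_add lookup_evar)
        with 2 i ij assms show ?thesis unfolding mem
          by (auto simp: lookup_add lookup_evar split: if_splits)
      qed
    qed
  next
    fix m assume "m \<in> lex_std n k a p"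
    then show "evar n + m \<in> lex_std n k a p"
      using assms unfolding mem by (auto simp: lookup_add lookup_evar)
  }
qed

lemma card_exp_std:
  assumes "Suc l < q" "q \<le> n" "1 \<le> a" "a \<le> t"
  shows "card (slice (exp_std n l a q) t) =
    (\<Sum>i<a. (t - i + (n - Suc (Suc l))) choose (n - Suc (Suc l))) + ((t - a + (n - q)) choose (n - q)) + 1"
proof -
  have "plane_std n (Suc l) a q \<inter> cone n (evar l) n = {}"
    using assms by (auto simp: mem_plane_std cone_def lookup_evar)
  then have "card (slice (exp_std n l a q) t) = card (slice (plane_std n (Suc l) a q) t) + card (slice (cone n (evar l) n) t)"
    unfolding exp_std_def by (rule card_slice_Un[OF _ plane_std_mons cone_mons])
  then show ?thesis using assms by (simp add: card_plane_std card_cone)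
qed

lemma card_lex_std:
  assumes "k < p" "p < n" "a < t"
  shows "card (slice (lex_std n k a p) t) =
    (\<Sum>i<a. (t - i + (n - Suc k)) choose (n - Suc k)) + ((t - a + (n - Suc p)) choose (n - Suc p)) + 1"
proof -
  have "plane_std n k a (Suc p) \<inter> cone n (evar p + Poly_Mapping.single k a) n = {}"
    using assms by (auto simp: mem_plane_std mem_cone_lex)
  then have "card (slice (lex_std n k a p) t)
      = card (slice (plane_std n k a (Suc p)) t) + card (slice (cone n (evar p + Poly_Mapping.single k a) n) t)"
    unfolding lex_std_def by (rule card_slice_Un[OF _ plane_std_mons cone_mons])
  moreover have "Poly_Mapping.keys (evar p + Poly_Mapping.single k a) \<subseteq> {..<n}"
    using assms by (auto simp: keys_add_nat)
  ultimately show ?thesis using assms by (simp add: card_plane_std card_cone)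
qed

section \<open>The Hilbert polynomial as a count of cones\<close>

definition hpoly :: "nat \<Rightarrow> nat \<Rightarrow> nat \<Rightarrow> nat \<Rightarrow> nat" where
  "hpoly d r a t = (\<Sum>i<a. (t - i + d) choose d) + ((t - a + r) choose r) + 1"

text \<open>Telescoping of Pascal's rule, one summand for each unit by which the argument is
  lowered.\<close>

lemma choose_diff_sum:
  "m \<le> t \<Longrightarrow> int ((t + i) choose (i + 1)) - int ((t + i - m) choose (i + 1)) = (\<Sum>j<m. int ((t - Suc j + i) choose i))"
proof (induction m)
  case 0
  then show ?case by simp
next
  case (Suc m)
  then have "t + i - m = Suc (t - Suc m + i)" by simp
  then have "(t + i - m) choose (i + 1) = ((t - Suc m + i) choose i) + ((t + i - Suc m) choose (i + 1))"
    using Suc.prems by simp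
  then show ?case using Suc by simp
qed

lemma sum_choose_diagonal: "(\<Sum>i\<le>d. (s + i) choose i) = (s + d + 1) choose d"
  using sum_choose_lower[of s d] by simp

text \<open>Each difference in \<open>Q\<close> becomes a sum over \<open>j < m_i\<close>. After
  swapping the sums, a fixed \<open>j < a\<close> collects a full diagonal \<open>i <= d\<close>,
  while the additional index \<open>j = a\<close> occurs only for \<open>i <= r\<close>; the hockey
  stick identity evaluates both.\<close>

lemma Q_dr_hpoly:
  assumes "r < d" "a < t"
  shows "Q_dr d r a t + 1 = int (hpoly d r a t)"
proof -
  have Qm: "Qm (\<lambda>j. if j = d then a else if j = r then 1 else 0) d i = (if i \<le> r then Suc a else a)" if "i \<le> d" for i
  proof -
    have "Qm (\<lambda>j. if j = d then a else if j = r then 1 else 0) d i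
        = (\<Sum>j=i..d. (if j = d then a else 0) + (if j = r then 1 else 0))"
      unfolding Qm_def by (rule sum.cong) (use assms in auto)
    then show ?thesis using that assms by (simp add: sum.distrib)
  qed
  have "Q_dr d r a t = (\<Sum>i=0..d. int ((t + i) choose (i + 1)) - int ((t + i - (if i \<le> r then Suc a else a)) choose (i + 1)))"
    unfolding Q_dr_def Qpoly_def by (rule sum.cong) (auto simp: Qm)
  also have "\<dots> = (\<Sum>i=0..d. (\<Sum>j<a. int ((t - Suc j + i) choose i)) + (if i \<le> r then int ((t - Suc a + i) choose i) else 0))"
  proof (rule sum.cong)
    fix i
    show "int ((t + i) choose (i + 1)) - int ((t + i - (if i \<le> r then Suc a else a)) choose (i + 1))
        = (\<Sum>j<a. int ((t - Suc j + i) choose i)) + (if i \<le> r then int ((t - Suc a + i) choose i) else 0)"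
      using choose_diff_sum[of "Suc a" t i] choose_diff_sum[of a t i] assms(2)
      by (simp only: sum.lessThan_Suc split: if_split) simp
  qed simp
  also have "\<dots> = (\<Sum>j<a. \<Sum>i=0..d. int ((t - Suc j + i) choose i)) + (\<Sum>i\<in>{0..d} \<inter> {i. i \<le> r}. int ((t - Suc a + i) choose i))"
    by (simp add: sum.distrib sum.inter_restrict) (rule sum.swap)
  also have "{0..d} \<inter> {i. i \<le> r} = {..r}" using assms by auto
  also have "(\<Sum>j<a. \<Sum>i=0..d. int ((t - Suc j + i) choose i)) = (\<Sum>j<a. int ((t - j + d) choose d))"
  proof (rule sum.cong)
    fix j assume "j \<in> {..<a}"
    then have "t - Suc j + d + 1 = t - j + d" using assms by simp
    then show "(\<Sum>i=0..d. int ((t - Suc j + i) choose i)) = int ((t - j + d) choose d)"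
      unfolding of_nat_sum[symmetric] atLeast0AtMost by (metis sum_choose_diagonal)
  qed simp
  also have "(\<Sum>i\<le>r. int ((t - Suc a + i) choose i)) = int ((t - a + r) choose r)"
  proof -
    have "t - Suc a + r + 1 = t - a + r" using assms by simp
    then show ?thesis unfolding of_nat_sum[symmetric] by (metis sum_choose_diagonal)
  qed
  finally show ?thesis by (simp add: hpoly_def)
qed

lemma has_count_Q_dr:
  assumes "r < d" "\<And>t. t \<ge> t0 \<Longrightarrow> card (slice N t) = hpoly d r a t"
  shows "has_count (\<lambda>t. Q_dr d r a t + 1) N"
  unfolding has_count_def
  by (rule exI[of _ "max t0 (Suc a)"]) (use assms in \<open>auto simp: Q_dr_hpoly\<close>)

lemma has_count_Q_drD:
  assumes "has_count (\<lambda>t. Q_dr d r a t + 1) N" "r < d"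
  shows "\<exists>t0. \<forall>t\<ge>t0. card (slice N t) = hpoly d r a t"
proof -
  obtain t0 where t0: "\<And>t. t \<ge> t0 \<Longrightarrow> int (card (slice N t)) = Q_dr d r a t + 1"
    using assms(1) unfolding has_count_def by blast
  have "card (slice N t) = hpoly d r a t" if "t \<ge> max t0 (Suc a)" for t
    using t0[of t] Q_dr_hpoly[of r d a t] assms(2) that by simp
  then show ?thesis by blast
qed

section \<open>Generators\<close>

lemma Var_power: "Var i ^ c = Poly_Mapping.single (Poly_Mapping.single i c) 1"
  by (induction c) (auto simp: single_Suc Var_evar mult_single)

lemma complement_generated:
  assumes boi: "borel_order_ideal n N" and "\<And>g. g \<in> M \<Longrightarrow> g \<notin> N"
    and gen: "\<And>m. m \<in> mons n \<Longrightarrow> m \<notin> N \<Longrightarrow> \<exists>g\<in>M. \<forall>i. Poly_Mapping.lookup g i \<le> Poly_Mapping.lookup m i"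
  shows "{m \<in> mons n. \<forall>g\<in>M. \<forall>w. m \<noteq> w + g} = N"
proof (intro set_eqI iffI)
  fix m assume m: "m \<in> {m \<in> mons n. \<forall>g\<in>M. \<forall>w. m \<noteq> w + g}"
  show "m \<in> N"
  proof (rule ccontr)
    assume "m \<notin> N"
    then obtain g where g: "g \<in> M" "\<And>i. Poly_Mapping.lookup g i \<le> Poly_Mapping.lookup m i"
      using gen m by blast
    have "m = (m - g) + g" using g(2) by (intro poly_mapping_eqI) (simp add: mon_lookup)
    then show False using m g(1) by blast
  qed
next
  fix m assume "m \<in> N"
  then show "m \<in> {m \<in> mons n. \<forall>g\<in>M. \<forall>w. m \<noteq> w + g}"
    using boi_mons[OF boi] boi_down[OF boi] assms(2) by blast
qed

text \<open>Which generator divides a nonstandard monomial is decided by its first variable: index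
  below \<open>l\<close>, equal to \<open>l\<close>, or above \<open>l\<close>.\<close>

lemma I_exp_monideal:
  assumes "d + 2 \<le> n" "r < d" "1 \<le> a"
  shows "I_exp n d r a = (monideal n (exp_std n (n - d - 2) a (n - r)) :: 'k::comm_ring_1 mpoly set)"
proof -
  define l where "l = n - d - 2"
  define q where "q = n - r"
  have arith: "n - d - 2 = l" "n - d - 1 = Suc l" "n - r = q" "n - r - 1 = q - 1" "Suc l < q" "q \<le> n"
    using assms by (auto simp: l_def q_def)
  define M where "M = evar ` {i. i < l} \<union> (\<lambda>j. evar l + evar j) ` {j. l \<le> j \<and> j \<le> n - 1}
    \<union> (\<lambda>j. Poly_Mapping.single (Suc l) a + evar j) ` {j. Suc l \<le> j \<and> j \<le> q - 1}"
  note mem = exp_std_altdef[OF arith(5,6) assms(3)] mem_plane_std[OF arith(5)] lin_std_def Un_iff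
  have "I_exp n d r a = gen_ideal n ((\<lambda>m. Poly_Mapping.single m (1 :: 'k)) ` M)"
    unfolding I_exp_def arith M_def
    unfolding Var_power by (simp add: image_Un image_image setcompr_eq_image Var_evar mult_single)
  also have "M \<subseteq> mons n" unfolding M_def using arith by auto
  then have "gen_ideal n ((\<lambda>m. Poly_Mapping.single m (1 :: 'k)) ` M)
      = monideal n {m \<in> mons n. \<forall>g\<in>M. \<forall>w. m \<noteq> w + g}"
    by (rule gen_ideal_monomials)
  also have "{m \<in> mons n. \<forall>g\<in>M. \<forall>w. m \<noteq> w + g} = exp_std n l a q"
  proof (rule complement_generated[OF boi_exp_std[OF arith(5,6) assms(3)]])
    fix g assume "g \<in> M"
    then show "g \<notin> exp_std n l a q"
    proof -
      consider i where "g = evar i" "i < l" | j where "g = evar l + evar j" "j < n"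
        | j where "g = Poly_Mapping.single (Suc l) a + evar j" "Suc l \<le> j" "j < q"
        using \<open>g \<in> M\<close> arith(5,6) unfolding M_def by fastforce
      then show ?thesis
      proof cases
        case 1
        then have "Poly_Mapping.lookup g i \<noteq> 0" by (simp add: lookup_evar)
        then show ?thesis unfolding mem using 1(2) by auto
      next
        case 2
        then have "Poly_Mapping.lookup g l \<noteq> 0" "pdeg n g = 2"
          using arith(5,6) by (auto simp: lookup_add lookup_evar)
        then show ?thesis unfolding mem by auto
      next
        case 3
        then have "pdeg n g = Suc a" "Poly_Mapping.lookup g j > (if j = Suc l then a else 0)"
            "Poly_Mapping.lookup g (Suc l) \<ge> a"
          using arith(5,6) by (auto simp: lookup_add lookup_evar lookup_single_if)
        then show ?thesis unfolding mem using 3(2,3) assms(3)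
          by (cases "j = Suc l") auto
      qed
    qed
  next
    fix m assume m: "m \<in> mons n" "m \<notin> exp_std n l a q"
    consider i where "i < l" "Poly_Mapping.lookup m i > 0"
      | "\<forall>i<l. Poly_Mapping.lookup m i = 0" "Poly_Mapping.lookup m l > 0"
      | "\<forall>i<Suc l. Poly_Mapping.lookup m i = 0"
      by (metis less_Suc_eq neq0_conv)
    then show "\<exists>g\<in>M. \<forall>i. Poly_Mapping.lookup g i \<le> Poly_Mapping.lookup m i"
    proof cases
      case 1
      then show ?thesis unfolding M_def by (intro bexI[of _ "evar i"]) (auto simp: lookup_evar)
    next
      case 2
      have p: "pdeg n m > 1" using m 2 unfolding mem by auto
      \<comment> \<open>Besides one factor \<open>x_l\<close>, a second variable before
        \<open>x_n\<close> must divide \<open>m\<close>; if it is \<open>x_l\<close> again, exponent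
        2 is required.\<close>
      have "\<exists>j. l \<le> j \<and> j < n \<and> Poly_Mapping.lookup m j \<ge> (if j = l then 2 else 1)"
      proof (rule ccontr)
        assume "\<not> ?thesis"
        then have *: "Poly_Mapping.lookup m j < (if j = l then 2 else 1)" if "l \<le> j" "j < n" for j
          using that by (meson not_le)
        have "Poly_Mapping.lookup m j = 0" if "j < n" "j \<noteq> l" for j
          using 2(1) *[of j] that by (cases "j < l") auto
        then have "pdeg n m = (\<Sum>j\<in>{l}. Poly_Mapping.lookup m j)"
          unfolding pdeg_def using arith by (intro sum.mono_neutral_right) auto
        then show False using p *[of l] arith by simp
      qed
      then obtain j where j: "l \<le> j" "j < n" "Poly_Mapping.lookup m j \<ge> (if j = l then 2 else 1)" by blast
      have "evar l + evar j \<in> M" unfolding M_def using j by auto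
      then show ?thesis using j 2
        by (intro bexI[of _ "evar l + evar j"]) (auto simp: lookup_add lookup_evar split: if_splits)
    next
      case 3
      then have "\<exists>j. Suc l \<le> j \<and> j < q \<and> Poly_Mapping.lookup m (Suc l) \<ge> a
          \<and> Poly_Mapping.lookup m j \<ge> (if j = Suc l then Suc a else 1)"
      proof (cases "Poly_Mapping.lookup m (Suc l) > a")
        case True
        then show ?thesis using arith(5) by (intro exI[of _ "Suc l"]) auto
      next
        case False
        then obtain i where "Suc l < i" "i < q" "Poly_Mapping.lookup m i \<noteq> 0" "Poly_Mapping.lookup m (Suc l) = a"
          using m 3 unfolding mem by (auto simp: not_less)
        then show ?thesis by (intro exI[of _ i]) auto
      qed
      then obtain j where j: "Suc l \<le> j" "j < q" "Poly_Mapping.lookup m (Suc l) \<ge> a"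
          "Poly_Mapping.lookup m j \<ge> (if j = Suc l then Suc a else 1)" by blast
      have "Poly_Mapping.single (Suc l) a + evar j \<in> M" unfolding M_def using j by auto
      then show ?thesis using j
        by (intro bexI[of _ "Poly_Mapping.single (Suc l) a + evar j"])
          (auto simp: lookup_add lookup_evar lookup_single_if split: if_splits)
    qed
  qed
  finally show ?thesis unfolding arith .
qed

text \<open>If neither a variable before \<open>x_k\<close> nor some \<open>x_k^a x_j\<close> with
  \<open>k <= j < p\<close> divides a nonstandard monomial, its part before \<open>x_p\<close> is
  exactly \<open>x_k^a\<close>. Then \<open>x_p\<close> divides it, or it would be in the residual
  cone, and so does a further variable before \<open>x_n\<close>.\<close>

lemma I_lex_monideal:
  assumes "d + 2 \<le> n" "r < d"
  shows "I_lex n d r a = (monideal n (lex_std n (n - d - 1) a (n - r - 1)) :: 'k::comm_ring_1 mpoly set)"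
proof -
  define k where "k = n - d - 1"
  define p where "p = n - r - 1"
  have arith: "n - d - 1 = k" "n - r - 1 = p" "n - r - 2 = p - 1" "k < p" "p < n"
    using assms by (auto simp: k_def p_def)
  have l: "i \<le> n - d - 2 \<longleftrightarrow> i < k" for i
    using assms by (auto simp: k_def)
  have kp: "k < Suc p" using arith by simp
  define M where "M = evar ` {i. i < k} \<union> (\<lambda>j. Poly_Mapping.single k a + evar j) ` {j. k \<le> j \<and> j \<le> p - 1}
    \<union> (\<lambda>j. Poly_Mapping.single k a + evar p + evar j) ` {j. p \<le> j \<and> j \<le> n - 1}"
  note mem = lex_std_def mem_plane_std[OF kp] mem_cone_lex[OF arith(4,5)] Un_iff
  have "I_lex n d r a = gen_ideal n ((\<lambda>m. Poly_Mapping.single m (1 :: 'k)) ` M)"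
    unfolding I_lex_def arith M_def l
    unfolding Var_power by (simp add: image_Un image_image setcompr_eq_image Var_evar mult_single)
  also have "M \<subseteq> mons n" unfolding M_def using arith by auto
  then have "gen_ideal n ((\<lambda>m. Poly_Mapping.single m (1 :: 'k)) ` M)
      = monideal n {m \<in> mons n. \<forall>g\<in>M. \<forall>w. m \<noteq> w + g}"
    by (rule gen_ideal_monomials)
  also have "{m \<in> mons n. \<forall>g\<in>M. \<forall>w. m \<noteq> w + g} = lex_std n k a p"
  proof (rule complement_generated[OF boi_lex_std[OF arith(4,5)]])
    fix g assume "g \<in> M"
    then show "g \<notin> lex_std n k a p"
    proof -
      consider i where "g = evar i" "i < k" | j where "g = Poly_Mapping.single k a + evar j" "k \<le> j" "j < p"
        | j where "g = Poly_Mapping.single k a + evar p + evar j" "p \<le> j" "j < n"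
        using \<open>g \<in> M\<close> arith(4,5) unfolding M_def by fastforce
      then show ?thesis
      proof cases
        case 1
        then have "Poly_Mapping.lookup g i \<noteq> 0" by (simp add: lookup_evar)
        then show ?thesis unfolding mem using 1(2) arith(4,5) by (auto intro: exI[of _ i])
      next
        case 2
        then have "Poly_Mapping.lookup g j > (if j = k then a else 0)" "Poly_Mapping.lookup g k \<ge> a"
            "Poly_Mapping.lookup g p = 0"
          using arith(4,5) by (auto simp: lookup_add lookup_evar lookup_single_if)
        then show ?thesis unfolding mem using 2(2,3)
          by (cases "j = k") auto
      next
        case 3
        then have "Poly_Mapping.lookup g j > (if j = p then 1 else 0)" "Poly_Mapping.lookup g k = a"
            "Poly_Mapping.lookup g p > 0"
          using arith(4,5) by (auto simp: lookup_add lookup_evar lookup_single_if)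
        then show ?thesis unfolding mem using 3(2,3) arith(4)
          by (cases "j = p") auto
      qed
    qed
  next
    fix m assume m: "m \<in> mons n" "m \<notin> lex_std n k a p"
    have low: "\<forall>i<k. Poly_Mapping.lookup m i = 0 \<Longrightarrow> Poly_Mapping.lookup m k \<ge> a"
      using m unfolding mem by (auto simp: not_less)
    consider i where "i < k" "Poly_Mapping.lookup m i > 0"
      | j where "k \<le> j" "j < p" "Poly_Mapping.lookup m k \<ge> a" "Poly_Mapping.lookup m j \<ge> (if j = k then Suc a else 1)"
      | "\<forall>i<k. Poly_Mapping.lookup m i = 0" "Poly_Mapping.lookup m k = a" "\<forall>i. k < i \<longrightarrow> i < p \<longrightarrow> Poly_Mapping.lookup m i = 0"
    proof (cases "\<forall>i<k. Poly_Mapping.lookup m i = 0")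
      case True
      show ?thesis
      proof (cases "Poly_Mapping.lookup m k = a \<and> (\<forall>i. k < i \<longrightarrow> i < p \<longrightarrow> Poly_Mapping.lookup m i = 0)")
        case False
        then have "\<exists>j. k \<le> j \<and> j < p \<and> Poly_Mapping.lookup m j \<ge> (if j = k then Suc a else 1)"
          using low[OF True] arith(4)
          by (cases "Poly_Mapping.lookup m k = a") (fastforce simp: Suc_le_eq intro: exI[of _ k])+
        then show ?thesis using that(2) low[OF True] by blast
      qed (use True that(3) in blast)
    qed (use that(1) in blast)
    then show "\<exists>g\<in>M. \<forall>i. Poly_Mapping.lookup g i \<le> Poly_Mapping.lookup m i"
    proof cases
      case 1
      then show ?thesis unfolding M_def by (intro bexI[of _ "evar i"]) (auto simp: lookup_evar)
    next
      case 2
      then have "Poly_Mapping.single k a + evar j \<in> M" unfolding M_def by auto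
      then show ?thesis using 2
        by (intro bexI[of _ "Poly_Mapping.single k a + evar j"])
          (auto simp: lookup_add lookup_evar lookup_single_if split: if_splits)
    next
      case 3
      have p: "Poly_Mapping.lookup m p \<noteq> 0"
      proof
        assume "Poly_Mapping.lookup m p = 0"
        then have "\<forall>i. k < i \<longrightarrow> i < Suc p \<longrightarrow> Poly_Mapping.lookup m i = 0"
          using 3(3) less_Suc_eq by metis
        with m 3 show False unfolding mem by blast
      qed
      have "\<exists>j. p \<le> j \<and> j < n \<and> Poly_Mapping.lookup m j \<ge> (if j = p then 2 else 1)"
      proof (cases "Poly_Mapping.lookup m p = 1")
        case True
        then obtain i where i: "i < n" "i \<noteq> k" "i \<noteq> p" "Poly_Mapping.lookup m i \<noteq> 0"
          using m 3 unfolding mem by blast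
        then have "p < i" using 3 by (metis linorder_neqE_nat)
        then show ?thesis using i by (intro exI[of _ i]) auto
      next
        case False
        then show ?thesis using p arith(5) by (intro exI[of _ p]) auto
      qed
      then obtain j where j: "p \<le> j" "j < n" "Poly_Mapping.lookup m j \<ge> (if j = p then 2 else 1)" by blast
      then have "Poly_Mapping.single k a + evar p + evar j \<in> M" unfolding M_def by auto
      then show ?thesis using j 3 p arith(4)
        by (intro bexI[of _ "Poly_Mapping.single k a + evar p + evar j"])
          (auto simp: lookup_add lookup_evar lookup_single_if split: if_splits)
    qed
  qed
  finally show ?thesis unfolding arith .
qed

section \<open>A third point in the exceptional cases\<close>

text \<open>For \<open>r = 1\<close>, \<open>a = 2\<close>: a double \<open>d\<close>-plane with a line through it, replacing the residual line
  and the extra point.\<close>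

definition line_std :: "nat \<Rightarrow> nat \<Rightarrow> mon set" where
  "line_std n l = powers_cone n (Suc l) 2 \<union> lin_std n l (n - 1)"

lemma boi_line_std: "Suc l < n \<Longrightarrow> borel_order_ideal n (line_std n l)"
  unfolding line_std_def by (intro boi_Un boi_powers_cone boi_lin_std) auto

text \<open>The new line contributes \<open>t\<close> monomials in degree \<open>t\<close>, as many
  as the residual line over \<open>x_k^2\<close> (\<open>t - 1\<close> of them) and the extra point
  together.\<close>

lemma card_line_std:
  assumes "Suc l < n - 1" "2 \<le> t"
  shows "card (slice (line_std n l) t) = (\<Sum>i<2. (t - i + (n - Suc (Suc l))) choose (n - Suc (Suc l))) + t"
proof -
  have eq: "line_std n l = powers_cone n (Suc l) 2 \<union> cone n (evar l) (n - 1)"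
    unfolding line_std_def by (rule powers_cone_lin_std) (use assms in auto)
  have "powers_cone n (Suc l) 2 \<inter> cone n (evar l) (n - 1) = {}"
    using assms by (auto simp: powers_cone_def cone_def lookup_evar)
  then have "card (slice (line_std n l) t)
      = card (slice (powers_cone n (Suc l) 2) t) + card (slice (cone n (evar l) (n - 1)) t)"
    unfolding eq by (rule card_slice_Un[OF _ powers_cone_mons cone_mons])
  then show ?thesis using assms by (simp add: card_powers_cone card_cone)
qed

text \<open>For \<open>r = 0\<close>, \<open>a \<ge> 2\<close>: both extra points sit in the direction \<open>x_l\<close>.\<close>

definition pts_std :: "nat \<Rightarrow> nat \<Rightarrow> nat \<Rightarrow> mon set" where
  "pts_std n l a = powers_cone n (Suc l) a \<union> cone n (evar l) n \<union> cone n (evar (n - 1) + evar l) n"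

text \<open>Without the last cone the set is a union of order ideals. From
  \<open>x_{n-1} x_l x_n^s\<close>, raising \<open>x_l\<close> leads into \<open>powers_cone\<close>
  and raising \<open>x_{n-1}\<close> leads to the cone over \<open>x_l\<close>.\<close>

lemma boi_pts_std:
  assumes "Suc l < n - 1" "2 \<le> a"
  shows "borel_order_ideal n (pts_std n l a)"
proof -
  let ?C = "cone n (evar (n - 1) + evar l) n"
  have eq: "pts_std n l a = (powers_cone n (Suc l) a \<union> lin_std n l n) \<union> ?C"
    unfolding pts_std_def using powers_cone_lin_std[of l n n a] assms by auto
  have boi: "borel_order_ideal n (powers_cone n (Suc l) a \<union> lin_std n l n)"
    using assms by (intro boi_Un boi_powers_cone boi_lin_std) auto
  have mem: "m \<in> ?C \<longleftrightarrow> m \<in> mons n \<and> Poly_Mapping.lookup m (n - 1) = 1 \<and> Poly_Mapping.lookup m l = 1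
      \<and> (\<forall>i<n. i \<noteq> l \<longrightarrow> i \<noteq> n - 1 \<longrightarrow> Poly_Mapping.lookup m i = 0)" for m
    using mem_cone_lex[of l "n - 1" n m 1] assms by (auto simp: evar_def)
  have step: "i = l \<or> i = n - 1" if "evar i + m \<in> ?C" "i < n" for i m
    using that unfolding mem by (auto simp: lookup_add lookup_evar split: if_splits)
  \<comment> \<open>After the move \<open>x_{l+1}\<close> has exponent at most 1; this is where
    \<open>2 <= a\<close> enters.\<close>
  have powers: "evar j + m \<in> powers_cone n (Suc l) a" if "evar l + m \<in> ?C" "l < j" "j \<le> n" for j m
    using that assms unfolding mem powers_cone_def
    by (auto simp: lookup_add lookup_evar less_Suc_eq split: if_splits)
  have lin: "m \<in> cone n (evar l) n" if "evar (n - 1) + m \<in> ?C" for m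
    using that assms unfolding mem by (auto simp: cone_def lookup_add lookup_evar split: if_splits)
  show ?thesis
    unfolding borel_order_ideal_def
  proof (intro conjI allI impI ballI)
    show "pts_std n l a \<subseteq> mons n"
      unfolding pts_std_def using powers_cone_mons cone_mons by blast
  next
    fix m i assume m: "evar i + m \<in> pts_std n l a"
    show "m \<in> pts_std n l a"
    proof (cases "evar i + m \<in> ?C")
      case True
      consider "i = l" | "i = n - 1" | "i = n" | "i > n"
        using step[OF True] by force
      then show ?thesis
      proof cases
        case 1
        \<comment> \<open>Division by \<open>x_l\<close> is split into an exchange of
          \<open>x_l\<close> for \<open>x_n\<close>, which lands in \<open>powers_cone\<close>, and
          a division by \<open>x_n\<close>.\<close>
        then have "evar n + m \<in> powers_cone n (Suc l) a"
          using powers[of m n] True assms by auto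
        then show ?thesis using boi_down1[OF boi_powers_cone] assms unfolding pts_std_def by auto
      next
        case 2
        then show ?thesis using lin True unfolding pts_std_def by blast
      next
        case 3
        then have "m \<in> ?C" using True assms unfolding mem by (auto simp: lookup_add lookup_evar split: if_splits)
        then show ?thesis unfolding pts_std_def by blast
      next
        case 4
        then show ?thesis using True cone_mons by fastforce
      qed
    next
      case False
      then show ?thesis using m boi_down1[OF boi] unfolding eq by blast
    qed
  next
    fix m i j assume m: "evar i + m \<in> pts_std n l a" and ij: "i < j" "j \<le> n"
    show "evar j + m \<in> pts_std n l a"
    proof (cases "evar i + m \<in> ?C")
      case True
      then consider "i = l" | "i = n - 1" using step[of i m] ij by auto
      then show ?thesis
      proof cases
        case 1
        then show ?thesis using powers True ij unfolding pts_std_def by blast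
      next
        case 2
        then have "j = n" using ij by auto
        moreover have "m \<in> powers_cone n (Suc l) a \<union> lin_std n l n"
          using lin True 2 powers_cone_lin_std[of l n n a] assms by auto
        ultimately show ?thesis unfolding eq using boi_last1[OF boi] by blast
      qed
    next
      case False
      then show ?thesis using m boi_swap[OF boi] ij unfolding eq by (meson UnE UnI1 less_imp_le)
    qed
  next
    fix m assume m: "m \<in> pts_std n l a"
    show "evar n + m \<in> pts_std n l a"
    proof (cases "m \<in> ?C")
      case True
      then have "evar n + m \<in> ?C" using assms unfolding mem by (auto simp: lookup_add lookup_evar)
      then show ?thesis unfolding pts_std_def by blast
    next
      case False
      then show ?thesis using m boi_last1[OF boi] unfolding eq by blast
    qed
  qed
qed

lemma card_pts_std:
  assumes "Suc l < n - 1" "a \<le> t" "2 \<le> t"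
  shows "card (slice (pts_std n l a) t) = (\<Sum>i<a. (t - i + (n - Suc (Suc l))) choose (n - Suc (Suc l))) + 2"
proof -
  have "powers_cone n (Suc l) a \<inter> cone n (evar l) n = {}"
    using assms by (auto simp: powers_cone_def cone_def lookup_evar)
  then have "card (slice (powers_cone n (Suc l) a \<union> cone n (evar l) n) t)
      = card (slice (powers_cone n (Suc l) a) t) + card (slice (cone n (evar l) n) t)"
    by (rule card_slice_Un[OF _ powers_cone_mons cone_mons])
  moreover have "(powers_cone n (Suc l) a \<union> cone n (evar l) n) \<inter> cone n (evar (n - 1) + evar l) n = {}"
  proof -
    have "powers_cone n (Suc l) a \<inter> cone n (evar (n - 1) + evar l) n = {}"
      using assms by (force simp: powers_cone_def cone_def lookup_evar lookup_add)
    moreover have "cone n (evar l) n \<inter> cone n (evar (n - 1) + evar l) n = {}"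
      using assms by (intro cone_disjoint[of "n - 1"]) (auto simp: lookup_evar lookup_add)
    ultimately show ?thesis by blast
  qed
  then have "card (slice (pts_std n l a) t) = card (slice (powers_cone n (Suc l) a \<union> cone n (evar l) n) t)
      + card (slice (cone n (evar (n - 1) + evar l) n) t)"
    unfolding pts_std_def by (rule card_slice_Un) (use powers_cone_mons cone_mons in blast)+
  ultimately have "card (slice (pts_std n l a) t) = card (slice (powers_cone n (Suc l) a) t)
      + card (slice (cone n (evar l) n) t) + card (slice (cone n (evar (n - 1) + evar l) n) t)"
    by simp
  moreover have "Poly_Mapping.keys (evar (n - 1) + evar l) \<subseteq> {..<n}"
    using assms by (auto simp: keys_add_nat)
  ultimately show ?thesis using assms by (simp add: card_powers_cone card_cone)
qed

section \<open>Classification\<close>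

lemma split_monom_deg: "c \<le> monom_deg v \<Longrightarrow> \<exists>v' v''. v = v' + v'' \<and> monom_deg v' = c"
proof -
  have "Poly_Mapping.keys v \<subseteq> UNIV" by simp
  then show "c \<le> monom_deg v \<Longrightarrow> ?thesis"
  proof (induction arbitrary: c rule: mon_induct_in)
    case zero
    then show ?case by (intro exI[of _ "0 :: mon"]) simp
  next
    case (add i v)
    show ?case
    proof (cases c)
      case 0
      then show ?thesis by (intro exI[of _ "0 :: mon"] exI[of _ "evar i + v"]) simp
    next
      case (Suc c')
      then obtain v' v'' where "v = v' + v''" "monom_deg v' = c'"
        using add.IH[of c'] add.prems by auto
      then show ?thesis using Suc
        by (intro exI[of _ "evar i + v'"] exI[of _ v'']) (simp add: ac_simps)
    qed
  qed
qed

text \<open>The part of \<open>m\<close> in the first \<open>p\<close> variables, i.e. the apex of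
  the cone in \<open>x_p,...,x_n\<close> that contains \<open>m\<close>.\<close>

definition trunc :: "nat \<Rightarrow> mon \<Rightarrow> mon" where
  "trunc p m = (\<Sum>i<p. Poly_Mapping.single i (Poly_Mapping.lookup m i))"

lemma lookup_trunc: "Poly_Mapping.lookup (trunc p m) i = (if i < p then Poly_Mapping.lookup m i else 0)"
  by (auto simp: trunc_def lookup_sum lookup_single_if)

lemma keys_trunc: "Poly_Mapping.keys (trunc p m) \<subseteq> {..<p}"
  by (auto simp: in_keys_iff lookup_trunc split: if_splits)

lemma monom_deg_trunc: "monom_deg (trunc p m) = pdeg p m"
  using monom_deg_pdeg[OF keys_trunc] by (simp add: pdeg_def lookup_trunc)

lemma mem_cone_trunc: "m \<in> mons n \<Longrightarrow> m \<in> cone n (trunc p m) p"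
  by (simp add: cone_def lookup_trunc)

lemma finite_monoms_le: "finite V \<Longrightarrow> finite {v. Poly_Mapping.keys v \<subseteq> V \<and> monom_deg v \<le> c}"
proof -
  assume V: "finite V"
  have "finite {v. Poly_Mapping.keys v \<subseteq> V \<and> monom_deg v = s}" for s
  proof (cases "V = {}")
    case True
    then show ?thesis by (auto intro: finite_subset[of _ "{0}"])
  next
    case False
    then show ?thesis using card_monoms[OF V] by blast
  qed
  then have "finite (\<Union>s\<le>c. {v. Poly_Mapping.keys v \<subseteq> V \<and> monom_deg v = s})" by blast
  then show ?thesis by (rule rev_finite_subset) auto
qed

lemma card_cone_le:
  assumes "Poly_Mapping.keys u \<subseteq> {..<p}" "p \<le> n"
  shows "card (slice (cone n u p) t) \<le> (t + (n - p)) choose (n - p)"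
  unfolding card_cone[OF assms] by (auto intro: binomial_right_mono)

text \<open>Only finitely many truncations to \<open>x_0,...,x_p\<close> have bounded degree, and
  each spans a cone in the \<open>n - p\<close> remaining variables.\<close>

lemma card_low_pdeg:
  assumes "p < n"
  shows "\<exists>L. \<forall>t. card (slice {m \<in> mons n. pdeg (Suc p) m < K} t) \<le> L * ((t + (n - Suc p)) choose (n - Suc p))"
proof -
  define W where "W = {v. Poly_Mapping.keys v \<subseteq> {..<Suc p} \<and> monom_deg v \<le> K}"
  have fin: "finite W" unfolding W_def by (rule finite_monoms_le) simp
  have "card (slice {m \<in> mons n. pdeg (Suc p) m < K} t) \<le> card W * ((t + (n - Suc p)) choose (n - Suc p))" for t
  proof -
    have "slice {m \<in> mons n. pdeg (Suc p) m < K} t \<subseteq> (\<Union>v\<in>W. slice (cone n v (Suc p)) t)"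
    proof
      fix m assume m: "m \<in> slice {m \<in> mons n. pdeg (Suc p) m < K} t"
      then have "trunc (Suc p) m \<in> W" using keys_trunc by (auto simp: W_def slice_def monom_deg_trunc)
      moreover have "m \<in> slice (cone n (trunc (Suc p) m) (Suc p)) t"
        using m mem_cone_trunc by (auto simp: slice_def)
      ultimately show "m \<in> (\<Union>v\<in>W. slice (cone n v (Suc p)) t)" by blast
    qed
    then have "card (slice {m \<in> mons n. pdeg (Suc p) m < K} t) \<le> card (\<Union>v\<in>W. slice (cone n v (Suc p)) t)"
      using fin finite_slice[OF cone_mons] by (intro card_mono) auto
    also have "\<dots> \<le> (\<Sum>v\<in>W. card (slice (cone n v (Suc p)) t))" by (rule card_UN_le[OF fin])
    also have "\<dots> \<le> (\<Sum>v\<in>W. (t + (n - Suc p)) choose (n - Suc p))"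
      by (rule sum_mono, rule card_cone_le) (use assms in \<open>auto simp: W_def\<close>)
    finally show ?thesis by simp
  qed
  then show ?thesis by blast
qed

lemma choose_drop:
  assumes "1 \<le> s" "a \<le> t"
  shows "(t + s) choose s \<le> ((t - a + s) choose s) + a * ((t + (s - 1)) choose (s - 1))"
  using assms(2)
proof (induction a)
  case 0
  then show ?case by simp
next
  case (Suc a)
  obtain c where c: "s = Suc c" using assms(1) by (cases s) auto
  have eq: "t - a + s = Suc (t - Suc a + s)" using Suc.prems by simp
  have "(t - a + s) choose s = ((t - Suc a + s) choose (s - 1)) + ((t - Suc a + s) choose s)"
    using c unfolding eq by simp
  moreover have "(t - Suc a + s) choose (s - 1) \<le> (t + (s - 1)) choose (s - 1)"
    using Suc.prems c by (intro binomial_right_mono) simp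
  ultimately show ?case using Suc.IH Suc.prems unfolding mult_Suc by linarith
qed

text \<open>The quotient of C(t+s,s) by C(t+s-1,s-1) is (t+s)/s, hence unbounded; the shift by
  \<open>a\<close> costs only a multiple of the lower binomial, by
  \<open>choose_drop\<close>.\<close>

lemma choose_growth:
  assumes "1 \<le> s"
  shows "\<exists>t0. \<forall>t\<ge>t0. M * ((t + (s - 1)) choose (s - 1)) < (t - a + s) choose s"
proof (intro exI allI impI)
  \<comment> \<open>From \<open>s (M + a) <= t\<close> on, the quotient (t+s)/s exceeds
    \<open>M + a\<close>; the summand \<open>a\<close> pays for \<open>choose_drop\<close>.\<close>
  fix t assume t: "t \<ge> max a (s * (M + a))"
  obtain c where c: "s = Suc c" using assms by (cases s) auto
  let ?C = "(t + c) choose c"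
  have "?C > 0" by simp
  have "s * ((M + a) * ?C) < Suc (t + c) * ?C"
    unfolding mult.assoc[symmetric]
    using t \<open>?C > 0\<close> by (intro mult_strict_right_mono) auto
  also have "\<dots> = s * ((t + s) choose s)"
    using Suc_times_binomial_eq[of "t + c" c] unfolding c add_Suc_right by (simp only: mult.commute)
  finally have "s * ((M + a) * ?C) < s * ((t + s) choose s)" .
  then have "(M + a) * ?C < (t + s) choose s" using assms by simp
  also have "\<dots> \<le> ((t - a + s) choose s) + a * ?C"
    using choose_drop[OF assms, of a t] t c by simp
  finally show "M * ((t + (s - 1)) choose (s - 1)) < (t - a + s) choose s"
    using c by (simp add: distrib_right)
qed

lemma choose_mono_diag: "s \<le> s' \<Longrightarrow> (x + s) choose s \<le> (x + s') choose s'"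
  using binomial_right_mono[of "x + s" "x + s'" x] binomial_symmetric[of s "x + s"] binomial_symmetric[of s' "x + s'"]
  by simp

text \<open>\<open>F\<close> is enlarged by elements of least possible degree. Because two elements
  share degree 1, the degrees in increasing order are at most 0, 1, 1, 2, ..., \<open>j - 2\<close>,
  and the weight \<open>g\<close> favours small degrees.\<close>

lemma down_closed_family:
  fixes g :: "nat \<Rightarrow> nat"
  assumes down: "\<And>u v. u + v \<in> M \<Longrightarrow> u \<in> M" and xy: "evar x \<in> M" "evar y \<in> M" "x \<noteq> y"
    and g: "antimono g" and size: "infinite M \<or> j \<le> card M"
  shows "3 \<le> j \<Longrightarrow> \<exists>F\<subseteq>M. finite F \<and> card F = j \<and> evar x \<in> F \<and> evar y \<in> F
    \<and> g 0 + g 1 + (\<Sum>i=1..j-2. g i) \<le> (\<Sum>u\<in>F. g (monom_deg u))"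
  using size
proof (induction j)
  case 0
  then show ?case by simp
next
  case (Suc j)
  have ne: "evar x \<noteq> evar y" using xy(3) by (metis keys_evar singleton_inject)
  have ne0: "evar i \<noteq> 0" for i by (metis keys_evar keys_zero insert_not_empty)
  show ?case
  proof (cases "j = 2")
    case True
    have "0 \<in> M" using down[of 0] xy by simp
    then show ?thesis using xy ne ne0[of x, symmetric] ne0[of y, symmetric] True
      by (intro exI[of _ "{0, evar x, evar y}"]) auto
  next
    case False
    with Suc.prems(1) have j: "3 \<le> j" by simp
    then obtain F where F: "F \<subseteq> M" "finite F" "card F = j" "evar x \<in> F" "evar y \<in> F"
        "g 0 + g 1 + (\<Sum>i=1..j-2. g i) \<le> (\<Sum>u\<in>F. g (monom_deg u))"
      using Suc by (metis Suc_leD)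
    \<comment> \<open>Otherwise the divisors of an element outside \<open>F\<close> put all degrees
      0, ..., \<open>j - 1\<close> into \<open>F\<close>. With only \<open>j\<close> elements each
      degree occurs once, contradicting \<open>evar x\<close> and \<open>evar y\<close>.\<close>
    have "\<exists>u. u \<in> M \<and> u \<notin> F \<and> monom_deg u \<le> j - 1"
    proof (rule ccontr)
      assume "\<not> ?thesis"
      then have big: "monom_deg u \<ge> j" if "u \<in> M" "u \<notin> F" for u
        using that j by fastforce
      have "\<not> M \<subseteq> F"
        using Suc.prems(2) F by (metis card_mono finite_subset not_less_eq_eq order_refl)
      then obtain v where v: "v \<in> M" "v \<notin> F" by blast
      have "{..<j} \<subseteq> monom_deg ` F"
      proof
        fix s assume "s \<in> {..<j}"
        then have "s \<le> monom_deg v" using big[OF v] by simp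
        then obtain v' v'' where "v = v' + v''" "monom_deg v' = s" using split_monom_deg by blast
        then show "s \<in> monom_deg ` F" using down v big[of v'] \<open>s \<in> {..<j}\<close> by force
      qed
      then have "card {..<j} \<le> card (monom_deg ` F)" using F(2) by (intro card_mono) auto
      then have "inj_on monom_deg F"
        using F card_image_le[OF F(2), of monom_deg] by (intro eq_card_imp_inj_on) auto
      then show False using F(4,5) ne by (auto simp: inj_on_def)
    qed
    then obtain u where u: "u \<in> M" "u \<notin> F" "monom_deg u \<le> j - 1" by blast
    have "g (j - 1) \<le> g (monom_deg u)" using g u(3) by (simp add: antimonoD)
    moreover have "(\<Sum>i=1..Suc j - 2. g i) = (\<Sum>i=1..j-2. g i) + g (j - 1)"
    proof -
      have "Suc j - 2 = Suc (j - 2)" "Suc (j - 2) = j - 1" using j by auto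
      then show ?thesis by (metis One_nat_def Suc_eq_plus1 le_add2 sum.cl_ivl_Suc not_less)
    qed
    ultimately show ?thesis using F u
      by (intro exI[of _ "insert u F"]) auto
  qed
qed

section \<open>Order ideals with the prescribed count\<close>

locale std_monomials =
  fixes n d r a l q :: nat and N :: "mon set"
  assumes n: "n = Suc (Suc (l + d))" and rd: "r < d" and q: "q = n - r" and a: "1 \<le> a"
    and boi: "borel_order_ideal n N"
    and count: "\<exists>t0. \<forall>t\<ge>t0. card (slice N t) = hpoly d r a t"
begin

abbreviation "k \<equiv> Suc l"

lemma kq: "k < q" "q \<le> n" "Suc k \<le> q" "k < n" "Suc k < n" "n - Suc k = d" "n - q = r"
  using n rd q by auto

text \<open>Apexes of the cones \<open>u k[x_{k+1},...,x_n]\<close> inside \<open>N\<close>, the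
  cones of the top dimension in the count. Powers of \<open>x_{k+1}\<close> suffice as a test by
  \<open>cone_subset_boi\<close>. Finiteness is not built in, which explains the disjunction in
  \<open>card_limit_monoms\<close>.\<close>

definition limit_monoms :: "mon set" where
  "limit_monoms = {u. Poly_Mapping.keys u \<subseteq> {..<Suc k} \<and> (\<forall>K. Poly_Mapping.single (Suc k) K + u \<in> N)}"

lemma limit_monoms_down: "u + v \<in> limit_monoms \<Longrightarrow> u \<in> limit_monoms"
  using boi_down[OF boi] by (auto simp: limit_monoms_def keys_add_nat) (metis add.assoc add.commute)

lemma limit_monoms_swap: "evar i + u \<in> limit_monoms \<Longrightarrow> i \<le> j \<Longrightarrow> j \<le> k \<Longrightarrow> evar j + u \<in> limit_monoms"
proof -
  assume u: "evar i + u \<in> limit_monoms" and ij: "i \<le> j" "j \<le> k"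
  have "Poly_Mapping.single (Suc k) K + (evar j + u) \<in> N" for K
  proof -
    have "evar i + (Poly_Mapping.single (Suc k) K + u) \<in> N" using u by (simp add: limit_monoms_def ac_simps)
    then have "evar j + (Poly_Mapping.single (Suc k) K + u) \<in> N"
      by (rule boi_swap[OF boi]) (use ij kq in auto)
    then show ?thesis by (simp add: ac_simps)
  qed
  then show "evar j + u \<in> limit_monoms" using u ij by (auto simp: limit_monoms_def keys_add_nat)
qed

lemma cone_limit_monoms: "u \<in> limit_monoms \<Longrightarrow> cone n u (Suc k) \<subseteq> N"
  using cone_subset_boi[OF boi, of u "Suc k"] kq by (auto simp: limit_monoms_def)

lemma slice_mono_card: "A \<subseteq> N \<Longrightarrow> card (slice A t) \<le> card (slice N t)"
  using finite_slice[OF boi_mons[OF boi]] by (intro card_mono) (auto simp: slice_def)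

text \<open>With fewer than \<open>a\<close> limit cones, the rest of \<open>N\<close> has bounded
  degree in \<open>x_0,...,x_{k+1}\<close>, hence growth of order \<open>d - 1\<close>, and the
  total stays below \<open>a\<close> times C(t-a+d,d).\<close>

lemma card_limit_monoms: "infinite limit_monoms \<or> a \<le> card limit_monoms"
proof (rule ccontr)
  assume "\<not> ?thesis"
  then have fin: "finite limit_monoms" and small: "card limit_monoms < a" by auto
  have deg_limit: "monom_deg v < a" if "v \<in> limit_monoms" for v
  proof -
    have "{..monom_deg v} \<subseteq> monom_deg ` limit_monoms"
      using split_monom_deg limit_monoms_down that by (metis atMost_iff imageI subsetI)
    then have "card {..monom_deg v} \<le> card limit_monoms"
      using fin by (metis card_image_le card_mono finite_imageI le_trans)
    then show ?thesis using small by simp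
  qed
  \<comment> \<open>Every truncation that is not a limit monomial has a divisor in this finite set:
    a divisor of degree \<open>a\<close> if there is one, otherwise itself. Degree \<open>a\<close>
    is too large for a limit monomial by \<open>deg_limit\<close>.\<close>
  define B where "B = {v. Poly_Mapping.keys v \<subseteq> {..<Suc k} \<and> monom_deg v \<le> a} - limit_monoms"
  have finB: "finite B" unfolding B_def using finite_monoms_le[of "{..<Suc k}" a] by simp
  have "\<forall>v\<in>B. \<exists>K. Poly_Mapping.single (Suc k) K + v \<notin> N" by (auto simp: B_def limit_monoms_def)
  then obtain f where f: "\<And>v. v \<in> B \<Longrightarrow> Poly_Mapping.single (Suc k) (f v) + v \<notin> N" by metis
  \<comment> \<open>One exponent that works for all of \<open>B\<close>; the sum serves as an upper
    bound of the \<open>f v\<close>.\<close>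
  define K where "K = (\<Sum>v\<in>B. f v)"
  have K: "Poly_Mapping.single (Suc k) K + v \<notin> N" if "v \<in> B" for v
  proof -
    have "f v \<le> K" unfolding K_def using finB that by (intro member_le_sum) auto
    then have "Poly_Mapping.single (Suc k) K = Poly_Mapping.single (Suc k) (K - f v) + Poly_Mapping.single (Suc k) (f v)"
      by (metis le_add_diff_inverse2 single_add)
    then show ?thesis using f[OF that] boi_down[OF boi] by (metis add.assoc)
  qed
  \<comment> \<open>Splitting off a divisor \<open>v'\<close> in \<open>B\<close> of degree at most
    \<open>a\<close>, a larger partial degree would let the cofactor be exchanged for
    \<open>x_{k+1}^K\<close>.\<close>
  have low: "pdeg (Suc (Suc k)) m < a + K" if m: "m \<in> N" "\<And>u. u \<in> limit_monoms \<Longrightarrow> m \<notin> cone n u (Suc k)" for m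
  proof (rule ccontr)
    assume big: "\<not> ?thesis"
    have m_mons: "m \<in> mons n" using m boi_mons[OF boi] by blast
    let ?v = "trunc (Suc k) m"
    have vT: "?v \<notin> limit_monoms" using m(2) mem_cone_trunc[OF m_mons] by blast
    obtain v' v'' where v: "?v = v' + v''" "monom_deg v' = min a (monom_deg ?v)"
      using split_monom_deg[of "min a (monom_deg ?v)" ?v] by auto
    have "v' \<notin> limit_monoms"
    proof (cases "a \<le> monom_deg ?v")
      case True
      then show ?thesis using deg_limit[of v'] v(2) by auto
    next
      case False
      then have "monom_deg v' = monom_deg (v' + v'')"
        using v(2) unfolding v(1)[symmetric] by simp
      then have "v'' = 0" by (simp add: monom_deg_eq_0_iff)
      then show ?thesis using vT v by simp
    qed
    moreover have "Poly_Mapping.keys v' \<subseteq> {..<Suc k}"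
      using keys_trunc[of "Suc k" m] unfolding v(1) by (simp add: keys_add_nat)
    ultimately have "v' \<in> B" using v by (auto simp: B_def)
    have "Poly_Mapping.lookup v' i \<le> Poly_Mapping.lookup m i" for i
    proof -
      have "Poly_Mapping.lookup v' i \<le> Poly_Mapping.lookup ?v i" unfolding v(1) by (simp add: lookup_add)
      then show ?thesis by (auto simp: lookup_trunc split: if_splits)
    qed
    then have eq: "m = v' + (m - v')" by (intro poly_mapping_eqI) (simp add: mon_lookup)
    have "pdeg (Suc (Suc k)) m = pdeg (Suc (Suc k)) v' + pdeg (Suc (Suc k)) (m - v')"
      by (subst eq) (rule pdeg_add)
    moreover have "pdeg (Suc (Suc k)) v' \<le> a" using pdeg_le_monom_deg[of "Suc (Suc k)" v'] v(2) by simp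
    ultimately have K_le: "K \<le> pdeg (Suc (Suc k)) (m - v')" using big by simp
    have in_N: "v' + (m - v') \<in> N" using eq m(1) by simp
    have "Suc k \<le> n" using kq by simp
    from boi_shift[OF boi this in_N K_le] have "Poly_Mapping.single (Suc k) K + v' \<in> N" .
    then show False using K[OF \<open>v' \<in> B\<close>] by blast
  qed
  obtain L where L: "\<And>t. card (slice {m \<in> mons n. pdeg (Suc (Suc k)) m < a + K} t)
      \<le> L * ((t + (n - Suc (Suc k))) choose (n - Suc (Suc k)))"
    using card_low_pdeg[of "Suc k" n "a + K"] kq by blast
  have nk: "n - Suc (Suc k) = d - 1" using kq by simp
  have d1: "1 \<le> d" using rd by simp
  \<comment> \<open>\<open>L\<close> bounds the rest of \<open>N\<close>; \<open>(a - 1) a\<close>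
    is the cost of replacing C(t+d,d) by C(t-a+d,d) in at most \<open>a - 1\<close> cones.\<close>
  obtain t1 where t1: "\<And>t. t \<ge> t1 \<Longrightarrow> (L + (a - 1) * a) * ((t + (d - 1)) choose (d - 1)) < (t - a + d) choose d"
    using choose_growth[OF d1] by blast
  obtain t2 where t2: "\<And>t. t \<ge> t2 \<Longrightarrow> card (slice N t) = hpoly d r a t" using count by blast
  define t where "t = max a (max t1 t2)"
  let ?X = "(t - a + d) choose d" and ?Y = "(t + (d - 1)) choose (d - 1)"
  have "slice N t \<subseteq> (\<Union>u\<in>limit_monoms. slice (cone n u (Suc k)) t) \<union> slice {m \<in> mons n. pdeg (Suc (Suc k)) m < a + K} t"
    using low boi_mons[OF boi] by (auto simp: slice_def)
  then have "card (slice N t) \<le> card ((\<Union>u\<in>limit_monoms. slice (cone n u (Suc k)) t) \<union> slice {m \<in> mons n. pdeg (Suc (Suc k)) m < a + K} t)"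
    using fin finite_slice[OF cone_mons] finite_slice[of "{m \<in> mons n. pdeg (Suc (Suc k)) m < a + K}" n t]
    by (intro card_mono) auto
  also have "\<dots> \<le> card (\<Union>u\<in>limit_monoms. slice (cone n u (Suc k)) t) + card (slice {m \<in> mons n. pdeg (Suc (Suc k)) m < a + K} t)"
    by (rule card_Un_le)
  also have "\<dots> \<le> (\<Sum>u\<in>limit_monoms. card (slice (cone n u (Suc k)) t)) + L * ?Y"
    using card_UN_le[OF fin] L[of t] nk by (intro add_mono) auto
  also have "(\<Sum>u\<in>limit_monoms. card (slice (cone n u (Suc k)) t)) \<le> (\<Sum>u\<in>limit_monoms. (t + d) choose d)"
  proof (rule sum_mono)
    fix u assume "u \<in> limit_monoms"
    then show "card (slice (cone n u (Suc k)) t) \<le> (t + d) choose d"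
      using card_cone_le[of u "Suc k" n t] kq by (auto simp: limit_monoms_def)
  qed
  also have "\<dots> = card limit_monoms * ((t + d) choose d)" by simp
  also have "\<dots> \<le> (a - 1) * ((t + d) choose d)" using small by (intro mult_right_mono) auto
  also have "\<dots> \<le> (a - 1) * (?X + a * ?Y)"
    using choose_drop[OF d1, of a t] by (intro mult_left_mono) (auto simp: t_def)
  finally have "card (slice N t) \<le> (a - 1) * ?X + (L + (a - 1) * a) * ?Y"
    by (simp only: distrib_left distrib_right mult.assoc add.assoc add.commute add.left_commute)
  also have "\<dots> < (a - 1) * ?X + ?X" using t1[of t] by (simp add: t_def)
  also have "\<dots> = a * ?X" using a by (cases a) auto
  also have "\<dots> = (\<Sum>i<a. ?X)" by simp
  also have "\<dots> \<le> (\<Sum>i<a. (t - i + d) choose d)" by (intro sum_mono binomial_right_mono) auto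
  also have "\<dots> \<le> card (slice N t)" using t2[of t] by (simp add: hpoly_def t_def)
  finally show False by simp
qed

text \<open>Distinct limit monomials differ in an exponent at some index up to \<open>k\<close>, so
  their cones are disjoint and the counts add up.\<close>

lemma card_limit_family:
  assumes "F \<subseteq> limit_monoms" "finite F"
  shows "(\<Sum>u\<in>F. if monom_deg u \<le> t then (t - monom_deg u + d) choose d else 0) \<le> card (slice N t)"
proof -
  have keys: "Poly_Mapping.keys u \<subseteq> {..<Suc k}" if "u \<in> F" for u using assms that by (auto simp: limit_monoms_def)
  have disj: "cone n u (Suc k) \<inter> cone n v (Suc k) = {}" if uv: "u \<in> F" "v \<in> F" "u \<noteq> v" for u v
  proof -
    obtain i where i: "Poly_Mapping.lookup u i \<noteq> Poly_Mapping.lookup v i" using uv(3) by (metis poly_mapping_eqI)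
    have "i \<in> Poly_Mapping.keys u \<or> i \<in> Poly_Mapping.keys v" using i by (auto simp: in_keys_iff)
    then have "i < Suc k" using keys[OF uv(1)] keys[OF uv(2)] by auto
    then show ?thesis using cone_disjoint i by blast
  qed
  have "(\<Sum>u\<in>F. if monom_deg u \<le> t then (t - monom_deg u + d) choose d else 0)
      = (\<Sum>u\<in>F. card (slice (cone n u (Suc k)) t))"
    by (intro sum.cong) (use keys kq in \<open>auto simp: card_cone\<close>)
  also have "\<dots> = card (slice (\<Union>u\<in>F. cone n u (Suc k)) t)"
    using assms(2) disj cone_mons by (rule card_slice_UN[symmetric])
  also have "\<dots> \<le> card (slice N t)" by (rule slice_mono_card) (use cone_limit_monoms assms(1) in blast)
  finally show ?thesis .
qed

text \<open>If the limit monomials are not long enough a chain of powers of \<open>x_k\<close>, one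
  of them involves an earlier variable, so \<open>x_l\<close> and \<open>x_k\<close> are both limit
  monomials. For \<open>a <= 2\<close> the claim is then immediate; for \<open>a >= 3\<close> two
  apexes of degree 1 make the count too large.\<close>

lemma power_limit_monom:
  assumes ra: "1 \<le> r \<or> a = 1"
  shows "Poly_Mapping.single k (a - 1) \<in> limit_monoms"
proof (rule ccontr)
  assume notin: "Poly_Mapping.single k (a - 1) \<notin> limit_monoms"
  have "\<not> limit_monoms \<subseteq> Poly_Mapping.single k ` {..<a - 1}"
  proof
    assume sub: "limit_monoms \<subseteq> Poly_Mapping.single k ` {..<a - 1}"
    then have "finite limit_monoms" using finite_subset by blast
    moreover have "card limit_monoms \<le> a - 1"
      using card_mono[OF _ sub] card_image_le[of "{..<a - 1}" "Poly_Mapping.single k"] by simp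
    ultimately show False using card_limit_monoms a by simp
  qed
  then obtain u where u: "u \<in> limit_monoms" "u \<notin> Poly_Mapping.single k ` {..<a - 1}" by blast
  have "\<exists>i<k. Poly_Mapping.lookup u i > 0"
  proof (rule ccontr)
    assume "\<not> ?thesis"
    then have *: "Poly_Mapping.lookup u i = 0" if "i \<noteq> k" for i
      using u(1) that by (auto simp: limit_monoms_def in_keys_iff subset_iff less_Suc_eq)
    let ?c = "Poly_Mapping.lookup u k"
    have eq: "u = Poly_Mapping.single k ?c"
      by (intro poly_mapping_eqI) (auto simp: lookup_single_if *)
    then have "a - 1 \<le> ?c" using u(2) by (metis imageI lessThan_iff not_le)
    then have "u = Poly_Mapping.single k (a - 1) + Poly_Mapping.single k (?c - (a - 1))"
      using eq by (metis le_add_diff_inverse single_add)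
    then show False using notin u(1) limit_monoms_down by metis
  qed
  then obtain i where i: "i < k" "Poly_Mapping.lookup u i > 0" by blast
  then have "evar i \<in> limit_monoms" using limit_monoms_down evar_factor u(1) by metis
  then have l_T: "evar l \<in> limit_monoms" using limit_monoms_swap[of i 0 l] i by simp
  then have k_T: "evar k \<in> limit_monoms" using limit_monoms_swap[of l 0 k] by simp
  have "0 \<in> limit_monoms" using limit_monoms_down[of 0 "evar l"] l_T by simp
  then have "a \<noteq> 1" using notin by auto
  moreover have "a \<noteq> 2" using notin k_T by (auto simp: evar_def)
  ultimately have a3: "3 \<le> a" using a by simp
  have r1: "1 \<le> r" using ra \<open>a \<noteq> 1\<close> by simp
  obtain t0 where t0: "\<And>t. t \<ge> t0 \<Longrightarrow> card (slice N t) = hpoly d r a t" using count by blast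
  define t where "t = t0 + a + 3"
  define g where "g s = (if s \<le> t then (t - s + d) choose d else 0)" for s
  have g: "antimono g" by (auto simp: antimono_def g_def intro: binomial_right_mono)
  have "l \<noteq> k" by simp
  \<comment> \<open>Degrees 0, 1, 1, 2, ..., a-2 or smaller, instead of 0, 1, ..., a-1, make the count too big.\<close>
  have "\<exists>F\<subseteq>limit_monoms. finite F \<and> card F = a \<and> evar l \<in> F \<and> evar k \<in> F
    \<and> g 0 + g 1 + (\<Sum>i=1..a-2. g i) \<le> (\<Sum>u\<in>F. g (monom_deg u))"
  proof (rule down_closed_family[OF _ l_T k_T \<open>l \<noteq> k\<close> g card_limit_monoms a3])
    show "u \<in> limit_monoms" if "u + v \<in> limit_monoms" for u v using that by (rule limit_monoms_down)
  qed
  then obtain F where F: "F \<subseteq> limit_monoms" "finite F" "g 0 + g 1 + (\<Sum>i=1..a-2. g i) \<le> (\<Sum>u\<in>F. g (monom_deg u))"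
    by (elim exE conjE) (rule that)
  have "(\<Sum>u\<in>F. g (monom_deg u)) \<le> card (slice N t)"
    unfolding g_def by (rule card_limit_family[OF F(1,2)])
  also have "\<dots> = (\<Sum>i<a. g i) + ((t - a + r) choose r) + 1"
    using t0[of t] by (simp add: hpoly_def g_def t_def)
  also have "(\<Sum>i<a. g i) = g 0 + (\<Sum>i=1..a-2. g i) + g (a - 1)"
  proof -
    have "{..<a} = insert 0 (insert (a - 1) {1..a-2})" using a3 by auto
    moreover have "a - 1 \<notin> {1..a-2}" using a3 by auto
    moreover have "0 \<notin> insert (a - 1) {1..a-2}" using a3 by auto
    ultimately show ?thesis by simp
  qed
  finally have 1: "g 1 \<le> g (a - 1) + ((t - a + r) choose r) + 1" using F(3) by simp
  \<comment> \<open>The inequality is weakest for \<open>a = 3\<close>, so it is refuted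
    there.\<close>
  have "g (a - 1) \<le> g 2" using antimonoD[OF g, of 2 "a - 1"] a3 by simp
  moreover have "(t - a + r) choose r \<le> (t - 3 + r) choose r" using a3 by (intro binomial_right_mono) simp
  ultimately have 2: "g 1 \<le> g 2 + ((t - 3 + r) choose r) + 1" using 1 by simp
  obtain s where s: "t = s + 3" by (simp add: t_def)
  obtain e where e: "d = Suc e" using rd by (cases d) auto
  obtain b where b: "r = Suc b" using r1 by (cases r) auto
  have "g 1 = g 2 + ((s + 2 + e) choose e)"
    \<comment> \<open>By Pascal, g(1) - g(2) is C(s+2+e,e), which is at least C(s+2+r,r) since
      \<open>r <= e\<close>. Two further Pascal steps make the latter exceed C(s+r,r) by at least 2,
      where \<open>r >= 1\<close> is essential.\<close>
    unfolding g_def s e by (simp add: numeral_2_eq_2 numeral_3_eq_3)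
  moreover have "(s + 2 + r) choose r \<le> (s + 2 + e) choose e"
    by (rule choose_mono_diag) (use rd e in auto)
  moreover have "(s + 2 + r) choose r = ((s + r) choose r) + ((s + 1 + r) choose b) + ((s + r) choose b)"
    unfolding b by simp
  moreover have "(s + 1 + r) choose b \<ge> 1" "(s + r) choose b \<ge> 1" using b by (auto simp: Suc_le_eq)
  moreover have "t - 3 + r = s + r" using s by simp
  ultimately show False using 2 by simp
qed

lemma powers_cone_subset:
  assumes "1 \<le> r \<or> a = 1"
  shows "powers_cone n k a \<subseteq> N"
proof -
  have "Poly_Mapping.single k i \<in> limit_monoms" if "i < a" for i
  proof -
    have "Poly_Mapping.single k (a - 1) = Poly_Mapping.single k i + Poly_Mapping.single k (a - 1 - i)"
      using that by (simp flip: single_add)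
    then show ?thesis using power_limit_monom[OF assms] limit_monoms_down by metis
  qed
  then show ?thesis unfolding powers_cone_UN using cone_limit_monoms by blast
qed

text \<open>If some \<open>x_q^K x_k^a\<close> were missing, then either all
  \<open>x_q^K x_l\<close> are standard, which the exact count excludes, or the part of
  \<open>N\<close> outside \<open>powers_cone\<close> has bounded degree in
  \<open>x_0,...,x_q\<close> and cannot supply C(t-a+r,r)+1 monomials.\<close>

lemma plane_cone_in_std:
  assumes cond: "(r = 0 \<and> a = 1) \<or> (r = 1 \<and> a \<noteq> 2) \<or> r \<ge> 2"
  shows "Poly_Mapping.single q K + Poly_Mapping.single k a \<in> N"
proof (rule ccontr)
  assume notin: "Poly_Mapping.single q K + Poly_Mapping.single k a \<notin> N"
  have base: "powers_cone n k a \<subseteq> N" by (rule powers_cone_subset) (use cond in auto)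
  obtain t0 where t0: "\<And>t. t \<ge> t0 \<Longrightarrow> card (slice N t) = hpoly d r a t" using count by blast
  have card_base: "card (slice (powers_cone n k a) t) = (\<Sum>i<a. (t - i + d) choose d)" if "a \<le> t" for t
    using card_powers_cone[of k n a t] kq that by simp
  have "\<exists>K'. Poly_Mapping.single q K' + evar l \<notin> N"
  proof (rule ccontr)
    assume "\<not> ?thesis"
    then have all: "Poly_Mapping.single q K' + evar l \<in> N" for K' by blast
    show False
    proof (cases "a = 1")
      case True
      have "evar l + Poly_Mapping.single q K \<in> N" using all[of K] by (simp add: add.commute)
      then have "evar k + Poly_Mapping.single q K \<in> N" by (rule boi_swap[OF boi]) (use kq in auto)
      then show False using notin True by (simp add: evar_def add.commute)
    next
      case False
      then have r1: "1 \<le> r" and a2: "2 \<le> a" using cond a by auto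
      have "cone n (evar l) q \<subseteq> N"
        by (rule cone_subset_boi[OF boi]) (use kq all in auto)
      define t where "t = t0 + a + 3"
      have "powers_cone n k a \<inter> cone n (evar l) q = {}"
        using kq by (auto simp: powers_cone_def cone_def lookup_evar)
      then have "card (slice (powers_cone n k a \<union> cone n (evar l) q) t)
          = (\<Sum>i<a. (t - i + d) choose d) + ((t - 1 + r) choose r)"
        using kq by (subst card_slice_Un[OF _ powers_cone_mons cone_mons]) (auto simp: card_base card_cone t_def)
      moreover have "\<dots> \<le> hpoly d r a t" if "card (slice (powers_cone n k a \<union> cone n (evar l) q) t) = \<dots>"
        using slice_mono_card[of "powers_cone n k a \<union> cone n (evar l) q" t] base \<open>cone n (evar l) q \<subseteq> N\<close> t0[of t] that
        by (simp add: t_def)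
      ultimately have 1: "(t - 1 + r) choose r \<le> ((t - a + r) choose r) + 1"
        by (simp add: hpoly_def)
      obtain s where s: "t = s + 2" by (simp add: t_def)
      obtain b where b: "r = Suc b" using r1 by (cases r) auto
      show False
      proof (cases "r = 1")
        case True
        \<comment> \<open>For \<open>r = 1\<close> the inequality reads
          \<open>t <= t - a + 2\<close>, so \<open>a = 2\<close>, the excluded value.\<close>
        then show False using 1 cond a2 by (simp add: t_def)
      next
        case False
        have "(t - a + r) choose r \<le> (s + r) choose r" using a2 s by (intro binomial_right_mono) simp
        moreover have "(t - 1 + r) choose r = ((s + r) choose r) + ((s + r) choose b)"
          unfolding b s by simp
        moreover have "(s + r) choose b \<ge> 2"
        proof -
          have "(s + r) choose b \<ge> Suc b choose b" unfolding b by (intro binomial_right_mono) simp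
          then show ?thesis using False b by simp
        qed
        ultimately show False using 1 by simp
      qed
    qed
  qed
  then obtain K' where K': "Poly_Mapping.single q K' + evar l \<notin> N" by blast
  define M where "M = K + K' + a"
  \<comment> \<open>Outside \<open>powers_cone\<close> either some \<open>x_i\<close> with
    \<open>i < k\<close> divides \<open>m\<close>, and is exchanged for \<open>x_l\<close>, or
    \<open>x_k^a\<close> does. In both cases \<open>boi_shift\<close> bounds the cofactor, by
    \<open>K'\<close> or \<open>K\<close>.\<close>
  have low: "pdeg (Suc q) m < Suc M" if m: "m \<in> N" "m \<notin> powers_cone n k a" for m
  proof -
    have m_mons: "m \<in> mons n" using m boi_mons[OF boi] by blast
    consider i where "i < k" "Poly_Mapping.lookup m i > 0" | "Poly_Mapping.lookup m k \<ge> a"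
      using m(2) m_mons unfolding powers_cone_def by fastforce
    then show ?thesis
    proof cases
      case 1
      then have eq: "m = evar i + (m - evar i)" using evar_factor by blast
      have "evar l + (m - evar i) \<in> N"
        by (rule boi_swap[OF boi, of i]) (use m 1 kq eq in auto)
      then have "\<not> K' \<le> pdeg (Suc q) (m - evar i)"
        using boi_shift[OF boi kq(2)] K' by blast
      moreover have "pdeg (Suc q) m = 1 + pdeg (Suc q) (m - evar i)"
        by (subst eq, subst pdeg_add) (use 1 kq in simp)
      ultimately show ?thesis by (simp add: M_def)
    next
      case 2
      then have eq: "m = Poly_Mapping.single k a + (m - Poly_Mapping.single k a)"
        by (intro poly_mapping_eqI) (auto simp: mon_lookup)
      then have "\<not> K \<le> pdeg (Suc q) (m - Poly_Mapping.single k a)"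
        using boi_shift[OF boi kq(2)] notin m(1) by metis
      moreover have "pdeg (Suc q) m = a + pdeg (Suc q) (m - Poly_Mapping.single k a)"
        by (subst eq, subst pdeg_add) (use kq in simp)
      ultimately show ?thesis by (simp add: M_def)
    qed
  qed
  let ?L = "{m \<in> mons n. pdeg (Suc q) m < Suc M}"
  have bound: "((t - a + r) choose r) + 1 \<le> card (slice ?L t)" if "t \<ge> t0" "t \<ge> a" for t
  proof -
    have "slice N t \<subseteq> slice (powers_cone n k a) t \<union> slice ?L t"
      using low boi_mons[OF boi] by (auto simp: slice_def)
    then have "card (slice N t) \<le> card (slice (powers_cone n k a) t \<union> slice ?L t)"
      using finite_slice[OF powers_cone_mons] finite_slice[of ?L n t] by (intro card_mono) auto
    also have "\<dots> \<le> card (slice (powers_cone n k a) t) + card (slice ?L t)" by (rule card_Un_le)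
    finally show ?thesis using t0[OF that(1)] card_base[OF that(2)] by (simp add: hpoly_def)
  qed
  show False
  proof (cases "r = 0")
    case True
    \<comment> \<open>Here \<open>q = n\<close>, so the partial degree is the full degree and the
      bound leaves nothing in large degrees.\<close>
    define t where "t = t0 + a + Suc M"
    have "slice ?L t = {}"
      using True q monom_deg_mons by (auto simp: slice_def t_def)
    then show False using bound[of t] by (simp add: t_def)
  next
    case False
    then have r1: "1 \<le> r" by simp
    have qn: "q < n" "n - Suc q = r - 1" using q r1 n rd by auto
    obtain L where L: "\<And>t. card (slice ?L t) \<le> L * ((t + (r - 1)) choose (r - 1))"
      using card_low_pdeg[OF qn(1), of "Suc M"] unfolding qn(2) by blast
    obtain t1 where t1: "\<And>t. t \<ge> t1 \<Longrightarrow> L * ((t + (r - 1)) choose (r - 1)) < (t - a + r) choose r"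
      using choose_growth[OF r1] by blast
    have "L * ((t0 + a + t1 + (r - 1)) choose (r - 1)) < (t0 + a + t1 - a + r) choose r"
      by (rule t1) simp
    then show False using bound[of "t0 + a + t1"] L[of "t0 + a + t1"] by simp
  qed
qed

text \<open>\<open>plane_std\<close> accounts for all but one monomial in each large degree. Any
  further monomial of \<open>N\<close> reduces by exchange and division to \<open>x_l\<close> or
  \<open>x_k^a x_{q-1}\<close>, and its multiples by powers of \<open>x_n\<close> fill the
  gap.\<close>

theorem exp_or_lex:
  assumes cond: "(r = 0 \<and> a = 1) \<or> (r = 1 \<and> a \<noteq> 2) \<or> r \<ge> 2"
  shows "N = exp_std n l a q \<or> N = lex_std n k a (q - 1)"
proof -
  obtain t0 where t0: "\<And>t. t \<ge> t0 \<Longrightarrow> card (slice N t) = hpoly d r a t" using count by blast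
  have q1: "Suc (q - 1) = q" "k < q - 1 \<or> k = q - 1" "q - 1 < n" using kq by auto
  have "k \<noteq> q - 1" using n rd q by auto
  with q1 have kq1: "k < q - 1" by blast
  have "powers_cone n k a \<subseteq> N" by (rule powers_cone_subset) (use cond in auto)
  moreover have "cone n (Poly_Mapping.single k a) q \<subseteq> N"
    by (rule cone_subset_boi[OF boi]) (use kq plane_cone_in_std[OF cond] in auto)
  ultimately have plane: "plane_std n k a q \<subseteq> N" unfolding plane_std_def by blast
  define t where "t = t0 + a + 1"
  have card_plane: "card (slice (plane_std n k a q) t) + 1 = card (slice N t)"
    using t0[of t] card_plane_std[of k q n a t] kq by (simp add: hpoly_def t_def)
  have "\<exists>m\<in>N. m \<notin> plane_std n k a q"
  proof (rule ccontr)
    assume "\<not> ?thesis"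
    then have "N = plane_std n k a q" using plane by blast
    then show False using card_plane by simp
  qed
  then obtain m where m: "m \<in> N" "m \<notin> plane_std n k a q" by blast
  have m_mons: "m \<in> mons n" using m boi_mons[OF boi] by blast
  consider i where "i < k" "Poly_Mapping.lookup m i > 0"
    | j where "k \<le> j" "j < q" "Poly_Mapping.lookup m k \<ge> a" "Poly_Mapping.lookup m j \<ge> (if j = k then Suc a else 1)"
  proof (cases "\<exists>i<k. Poly_Mapping.lookup m i > 0")
    case False
    then have *: "Poly_Mapping.lookup m k \<ge> a" "Poly_Mapping.lookup m k \<noteq> a \<or> (\<exists>j. k < j \<and> j < q \<and> Poly_Mapping.lookup m j \<noteq> 0)"
      using m(2) m_mons unfolding mem_plane_std[OF kq(1)] by auto
    show ?thesis
    proof (cases "Poly_Mapping.lookup m k = a")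
      case True
      then obtain j where "k < j" "j < q" "Poly_Mapping.lookup m j \<noteq> 0" using *(2) by blast
      then show ?thesis using that(2)[of j] *(1) by auto
    next
      case False
      then show ?thesis using that(2)[of k] *(1) kq(1) by auto
    qed
  qed (use that(1) in blast)
  then show ?thesis
  proof cases
    case 1
    then have eq: "m = evar i + (m - evar i)" using evar_factor by blast
    have "evar l + (m - evar i) \<in> N"
      by (rule boi_swap[OF boi, of i]) (use m 1 kq eq in auto)
    then have "evar l \<in> N" using boi_down[OF boi, of "m - evar i" "evar l"] by (simp add: add.commute)
    then have "cone n (evar l) n \<subseteq> N"
      by (intro cone_subset_boi[OF boi]) (use kq boi_last[OF boi] in auto)
    then have sub: "exp_std n l a q \<subseteq> N" unfolding exp_std_def using plane by blast
    have boi': "borel_order_ideal n (exp_std n l a q)" by (rule boi_exp_std) (use kq a in auto)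
    have "N = exp_std n l a q"
    proof (rule boi_eqI[OF boi boi' sub])
      fix t assume "max t0 a \<le> t"
      then show "card (slice N t) \<le> card (slice (exp_std n l a q) t)"
        using t0[of t] card_exp_std[of l q n a t] kq a by (simp add: hpoly_def)
    qed
    then show ?thesis by (rule disjI1)
  next
    case 2
    let ?w = "m - (evar j + Poly_Mapping.single k a)"
    have eq: "m = evar j + (Poly_Mapping.single k a + ?w)"
      using 2 by (intro poly_mapping_eqI) (auto simp: mon_lookup split: if_splits)
    \<comment> \<open>Since \<open>j <= q - 1\<close>, the factor \<open>x_j\<close> can be raised
      to \<open>x_{q-1}\<close>; the remaining factors are then divided out.\<close>
    have "evar (q - 1) + (Poly_Mapping.single k a + ?w) \<in> N"
      by (rule boi_swap[OF boi, of j]) (use m 2 kq eq in auto)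
    then have "evar (q - 1) + Poly_Mapping.single k a \<in> N"
      using boi_down[OF boi, of ?w "evar (q - 1) + Poly_Mapping.single k a"] by (simp add: ac_simps)
    then have "cone n (evar (q - 1) + Poly_Mapping.single k a) n \<subseteq> N"
      by (intro cone_subset_boi[OF boi]) (use kq q1 boi_last[OF boi] in \<open>auto simp: keys_add_nat\<close>)
    then have sub: "lex_std n k a (q - 1) \<subseteq> N" unfolding lex_std_def using plane q1(1) by simp
    have boi': "borel_order_ideal n (lex_std n k a (q - 1))" by (rule boi_lex_std) (use kq1 q1 in auto)
    have "N = lex_std n k a (q - 1)"
    proof (rule boi_eqI[OF boi boi' sub])
      fix t assume "max t0 (Suc a) \<le> t"
      then show "card (slice N t) \<le> card (slice (lex_std n k a (q - 1)) t)"
        using t0[of t] card_lex_std[of k "q - 1" n a t] kq kq1 q1 by (simp add: hpoly_def)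
    qed
    then show ?thesis by (rule disjI2)
  qed
qed

end

text \<open>Injectivity of \<open>monideal\<close> turns the number of ideals into the number of
  order ideals. For the excluded parameters it is enough to exhibit a third one.\<close>

theorem theorem2p15:
  fixes n d r ad :: nat
  assumes "alg_closed TYPE('k::field_char_0)"
    and "d + 2 \<le> n" and "r < d" and "1 \<le> ad"
  shows "(card (hilb_borel_points n (\<lambda>t. Q_dr d r ad t + 1) :: 'k mpoly set set) = 2
            \<longleftrightarrow> ((r = 0 \<and> ad = 1) \<or> (r = 1 \<and> ad \<noteq> 2) \<or> r \<ge> 2))
       \<and> (((r = 0 \<and> ad = 1) \<or> (r = 1 \<and> ad \<noteq> 2) \<or> r \<ge> 2) \<longrightarrow>
            (hilb_borel_points n (\<lambda>t. Q_dr d r ad t + 1) :: 'k mpoly set set)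
              = {I_exp n d r ad, I_lex n d r ad})"
proof -
  define l where "l = n - d - 2"
  define q where "q = n - r"
  have arith: "n - d - 2 = l" "n - d - 1 = Suc l" "n - r = q" "n - r - 1 = q - 1" "n = Suc (Suc (l + d))"
    using assms(2-3) by (auto simp: l_def q_def)
  have bounds: "Suc l < q" "Suc l < q - 1" "q \<le> n" "q - 1 < n" "Suc l < n - 1" "Suc (q - 1) = q"
      "n - Suc (Suc l) = d" "n - q = r" "l < n - 1" "l < n" "n - 1 < n"
    using assms(2-3) arith(5) by (auto simp: q_def)
  let ?P = "\<lambda>t. Q_dr d r ad t + 1"
  define S where "S = {N. borel_order_ideal n N \<and> has_count ?P N}"
  let ?E = "exp_std n l ad q" and ?L = "lex_std n (Suc l) ad (q - 1)"
  \<comment> \<open>The monomial \<open>x_{n-1} x_l\<close> lies in both exceptional order ideals,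
    but neither in the expanded nor in the lexicographic one.\<close>
  let ?w = "evar (n - 1) + evar l"
  have hilb: "(hilb_borel_points n ?P :: 'k mpoly set set) = monideal n ` S"
    unfolding S_def by (rule hilb_borel_points_eq)
  have inj: "inj_on (monideal n :: _ \<Rightarrow> 'k mpoly set) S"
  proof (rule inj_onI)
    fix x y assume "x \<in> S" "y \<in> S" "monideal n x = (monideal n y :: 'k mpoly set)"
    moreover have "x \<subseteq> mons n" "y \<subseteq> mons n" using calculation(1,2) boi_mons by (simp_all add: S_def)
    ultimately show "x = y" by (intro monideal_inj)
  qed
  then have card_hilb: "card (hilb_borel_points n ?P :: 'k mpoly set set) = card S"
    unfolding hilb by (rule card_image)
  have E: "?E \<in> S"
  proof -
    have "card (slice ?E t) = hpoly d r ad t" if "t \<ge> ad" for t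
      using card_exp_std[of l q n ad t] that bounds assms(4) by (simp add: hpoly_def)
    then show ?thesis
      using has_count_Q_dr[OF assms(3)] boi_exp_std bounds assms(4) unfolding S_def by blast
  qed
  have L: "?L \<in> S"
  proof -
    have "card (slice ?L t) = hpoly d r ad t" if "t \<ge> Suc ad" for t
      using card_lex_std[of "Suc l" "q - 1" n ad t] that bounds by (simp add: hpoly_def)
    then show ?thesis
      using has_count_Q_dr[OF assms(3)] boi_lex_std bounds unfolding S_def by blast
  qed
  have L_low: "Poly_Mapping.lookup m l = 0" if "m \<in> ?L" for m
    using that bounds unfolding lex_std_def
    by (auto simp: mem_plane_std mem_cone_lex)
  have "evar l \<in> ?E" using bounds by (auto simp: exp_std_def cone_def)
  moreover have "evar l \<notin> ?L" using L_low[of "evar l"] by (auto simp: lookup_evar)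
  ultimately have EL: "?E \<noteq> ?L" by blast
  have wE: "?w \<notin> ?E"
    using bounds assms(4) by (auto simp: exp_std_altdef mem_plane_std lin_std_def lookup_add lookup_evar)
  have wL: "?w \<notin> ?L"
    using L_low[of ?w] by (auto simp: lookup_add lookup_evar)
  show ?thesis
  proof (cases "(r = 0 \<and> ad = 1) \<or> (r = 1 \<and> ad \<noteq> 2) \<or> r \<ge> 2")
    case True
    have "N \<in> {?E, ?L}" if N: "N \<in> S" for N
    proof -
      interpret std_monomials n d r ad l q N
        by unfold_locales
          (use N assms(3,4) arith has_count_Q_drD[OF _ assms(3)] in \<open>auto simp: S_def\<close>)
      show ?thesis using exp_or_lex True by blast
    qed
    with E L have "S = {?E, ?L}" by blast
    moreover have "I_exp n d r ad = (monideal n ?E :: 'k mpoly set)"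
      using I_exp_monideal[OF assms(2-4)] unfolding arith(1-4) .
    moreover have "I_lex n d r ad = (monideal n ?L :: 'k mpoly set)"
      using I_lex_monideal[OF assms(2,3)] unfolding arith(1-4) .
    ultimately show ?thesis using True EL card_hilb hilb by simp
  next
    case False
    have "\<exists>N\<in>S. ?w \<in> N"
    proof (cases "r = 0")
      case True
      with False assms(4) have a2: "2 \<le> ad" by simp
      have "card (slice (pts_std n l ad) t) = hpoly d r ad t" if "t \<ge> ad" for t
        using card_pts_std[of l n ad t] that bounds a2 True by (simp add: hpoly_def)
      then have "pts_std n l ad \<in> S"
        using has_count_Q_dr[OF assms(3)] boi_pts_std bounds a2 unfolding S_def by blast
      moreover have "?w \<in> pts_std n l ad"
        using bounds by (auto simp: pts_std_def cone_def)
      ultimately show ?thesis by blast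
    next
      case r: False
      with False have ra: "r = 1" "ad = 2" by auto
      have "card (slice (line_std n l) t) = hpoly d r ad t" if "t \<ge> 2" for t
        using card_line_std[of l n t] that bounds ra by (simp add: hpoly_def)
      then have "line_std n l \<in> S"
        using has_count_Q_dr[OF assms(3)] boi_line_std bounds unfolding S_def
        by (metis (mono_tags, lifting) Suc_lessD less_diff_conv add_lessD1 mem_Collect_eq)
      moreover have "?w \<in> line_std n l"
        using bounds by (auto simp: line_std_def lin_std_def lookup_add lookup_evar)
      ultimately show ?thesis by blast
    qed
    then obtain N where N: "N \<in> S" "?w \<in> N" by blast
    have "card S \<noteq> 2"
    proof
      assume "card S = 2"
      \<comment> \<open>An infinite \<open>S\<close> would have \<open>card S = 0\<close>, so
        \<open>card S = 2\<close> also supplies the finiteness needed for monotonicity of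
        \<open>card\<close>.\<close>
      then have "card {?E, ?L, N} \<le> 2"
        using E L N(1) by (metis card.infinite card_mono empty_subsetI insert_subset zero_neq_numeral)
      moreover have "N \<noteq> ?E" "N \<noteq> ?L" using N(2) wE wL by auto
      ultimately show False using EL by simp
    qed
    then show ?thesis unfolding card_hilb using False by blast
  qed
qed

end
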